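(* Consider the system of the two ordinary differential equations $$\frac{d^2u}{dx^2}+2u^3-cu=e,\qquad \left(\frac{du}{dx}\right)^2+u^4-cu^2+d=2eu$$ for a real function $u(x)$, with real parameters $(c,d,e)$, and let $P(u):=u^4-cu^2+d-2eu$. (i) Fix $c>0$ and $e\in(-e_0,e_0)$ with $e_0:=\frac{2\sqrt{c^3}}{3\sqrt6}$. There exist $-\infty<d_1<d_2<\infty$ such that for every $d\in(d_1,d_2)$ the system admits the exact periodic solution in the form $$u(x)=u_4+\frac{(u_1-u_4)(u_2-u_4)}{(u_2-u_4)+(u_1-u_2)\,\mathrm{sn}^2(\nu x;\kappa)}\qquad (A)$$ with $\nu>0$ and $\kappa\in(0,1)$ given by $4\nu^2=(u_1-u_3)(u_2-u_4)$, $4\nu^2\kappa^2=(u_1-u_2)(u_3-u_4)$, and three other periodic solutions of the same period obtained with the symmetry transformations $$(S1)\ u_1\leftrightarrow u_2,\ u_3\leftrightarrow u_4;\qquad (S2)\ u_1\leftrightarrow u_3,\ u_2\leftrightarrow u_4;\qquad (S3)\ u_1\leftrightarrow u_4,\ u_2\leftrightarrow u_3 .$$ (ii) In addition, if $e\ne0$, there exists $d_3>d_2$ such that for every $d\in(-\infty,d_1)\cup(d_2,d_3)$ the system admits the exact periodic solution in the form $$u(x)=a+\frac{(b-a)(1-\mathrm{cn}(\nu x;\kappa))}{1+\delta+(\delta-1)\,\mathrm{cn}(\nu x;\kappa)}\qquad (B)$$ with $\delta>0$, $\nu>0$, $\kappa\in(0,1)$ given by $$\delta^2=\frac{(b-\alpha)^2+\beta^2}{(a-\alpha)^2+\beta^2},\quad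 \nu^2=\sqrt{[(a-\alpha)^2+\beta^2][(b-\alpha)^2+\beta^2]},\quad 2\kappa^2=1-\frac{(a-\alpha)(b-\alpha)+\beta^2}{\sqrt{[(a-\alpha)^2+\beta^2][(b-\alpha)^2+\beta^2]}},$$ and another periodic solution of the same period obtained with the symmetry transformation $(S0)\ a\leftrightarrow b$. (iii) For every other value of $(c,e)$ (that is, $c\le0$, or $c>0$ and $|e|\ge e_0$), there exists $d_1>0$ such that for every $d\in(-\infty,d_1)$ only the periodic solution in the form (B) exists, together with another solution obtained by the symmetry transformation (S0). All the solutions are unique up to the translational symmetry $u(x)\mapsto u(x+x_0)$, $x_0\in\mathbb{R}$.
   Context: $\mathrm{sn}(\cdot;\kappa)$ and $\mathrm{cn}(\cdot;\kappa)$ are the Jacobian elliptic functions with elliptic modulus $\kappa$. In form (A), $u_4\le u_3\le u_2\le u_1$ denote the four roots of $P$ when all of them are real; in form (B), $b\le a$ denote the two real roots of $P$ and $\alpha\pm i\beta$ its two complex-conjugate roots. The equations describe profiles of travelling waves $u(x-ct)$ of the modified Korteweg--de Vries equation $u_t+6u^2u_x+u_{xxx}=0$. Applying a symmetry transformation to (A) or (B) means performing the indicated exchanges of roots in the formula and in the formulas for its parameters ($\nu$ and $\kappa$ are unchanged; under (S0), $\delta$ becomes $\delta^{-1}$).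
   Formalization: In (iii), for c≤0 and e=0 the threshold is d_1=0 instead of d_1>0 (for d>0 there P>0 and no solution exists); for c>0 and |e|=e_0 the single value d=-c^2/12 is excluded (P has a triple root there, so form (B) does not exist). *)

theory Defs
  imports
    "HOL-Analysis.Analysis"
    "HOL-Computational_Algebra.Computational_Algebra"
    "HOL-Library.Periodic_Fun"
begin

text \<open>
  Jacobi's functions with elliptic modulus \<open>\<kappa>\<close> (so that \<open>\<kappa>\<^sup>2\<close> is the ``parameter''). The interval
  integral is oriented, so \<open>elliptic_F\<close> is odd in the upper limit; for \<open>0 < \<kappa> < 1\<close> it is an
  increasing bijection of the real line, and the amplitude is its inverse.
\<close>

definition elliptic_F :: "real \<Rightarrow> real \<Rightarrow> real" where
  "elliptic_F \<phi> \<kappa> = (LBINT \<theta>=0..\<phi>. 1 / sqrt (1 - \<kappa>\<^sup>2 * (sin \<theta>)\<^sup>2))"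

definition jacobi_am :: "real \<Rightarrow> real \<Rightarrow> real" where
  "jacobi_am x \<kappa> = inv (\<lambda>\<phi>. elliptic_F \<phi> \<kappa>) x"

definition jacobi_sn :: "real \<Rightarrow> real \<Rightarrow> real" where
  "jacobi_sn x \<kappa> = sin (jacobi_am x \<kappa>)"

definition jacobi_cn :: "real \<Rightarrow> real \<Rightarrow> real" where
  "jacobi_cn x \<kappa> = cos (jacobi_am x \<kappa>)"

definition mkdv_P :: "real \<Rightarrow> real \<Rightarrow> real \<Rightarrow> real poly" where
  "mkdv_P c d e = [:d, - 2 * e, - c, 0, 1:]"

lemma poly_mkdv_P: "poly (mkdv_P c d e) u = u ^ 4 - c * u\<^sup>2 + d - 2 * e * u"
  by (simp add: mkdv_P_def algebra_simps power2_eq_square power4_eq_xxxx)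

definition mkdv_solution :: "real \<Rightarrow> real \<Rightarrow> real \<Rightarrow> (real \<Rightarrow> real) \<Rightarrow> bool" where
  "mkdv_solution c d e u \<longleftrightarrow>
     (\<forall>x. u differentiable (at x)) \<and> (\<forall>x. deriv u differentiable (at x)) \<and>
     (\<forall>x. deriv (deriv u) x + 2 * u x ^ 3 - c * u x = e) \<and>
     (\<forall>x. (deriv u x)\<^sup>2 + u x ^ 4 - c * (u x)\<^sup>2 + d = 2 * e * u x)"

definition fundamental_period :: "(real \<Rightarrow> real) \<Rightarrow> real \<Rightarrow> bool" where
  "fundamental_period u T \<longleftrightarrow>
     0 < T \<and> periodic_fun_simple u T \<and> (\<forall>S. 0 < S \<and> S < T \<longrightarrow> \<not> periodic_fun_simple u S)"

definition translate_of :: "(real \<Rightarrow> real) \<Rightarrow> (real \<Rightarrow> real) \<Rightarrow> bool" where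
  "translate_of v u \<longleftrightarrow> (\<exists>x0. v = (\<lambda>x. u (x + x0)))"

definition e_crit :: "real \<Rightarrow> real" where
  "e_crit c = 2 * sqrt (c ^ 3) / (3 * sqrt 6)"

text \<open>The third root occurs in form (A) only through \<open>\<nu>\<close> and \<open>\<kappa>\<close>, but is moved by the symmetries.\<close>

definition form_A ::
  "real \<Rightarrow> real \<Rightarrow> real \<Rightarrow> real \<Rightarrow> real \<Rightarrow> real \<Rightarrow> real \<Rightarrow> real" where
  "form_A u1 u2 u3 u4 \<nu> \<kappa> x =
     u4 + (u1 - u4) * (u2 - u4) / ((u2 - u4) + (u1 - u2) * (jacobi_sn (\<nu> * x) \<kappa>)\<^sup>2)"

definition params_A :: "real \<Rightarrow> real \<Rightarrow> real \<Rightarrow> real \<Rightarrow> real \<Rightarrow> real \<Rightarrow> bool" where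
  "params_A u1 u2 u3 u4 \<nu> \<kappa> \<longleftrightarrow>
     0 < \<nu> \<and> 0 < \<kappa> \<and> \<kappa> < 1 \<and>
     4 * \<nu>\<^sup>2 = (u1 - u3) * (u2 - u4) \<and>
     4 * \<nu>\<^sup>2 * \<kappa>\<^sup>2 = (u1 - u2) * (u3 - u4)"

definition form_B ::
  "real \<Rightarrow> real \<Rightarrow> real \<Rightarrow> real \<Rightarrow> real \<Rightarrow> real \<Rightarrow> real" where
  "form_B a b \<delta> \<nu> \<kappa> x =
     a + (b - a) * (1 - jacobi_cn (\<nu> * x) \<kappa>) / (1 + \<delta> + (\<delta> - 1) * jacobi_cn (\<nu> * x) \<kappa>)"

definition params_B ::
  "real \<Rightarrow> real \<Rightarrow> real \<Rightarrow> real \<Rightarrow> real \<Rightarrow> real \<Rightarrow> real \<Rightarrow> bool" where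
  "params_B a b \<alpha> \<beta> \<delta> \<nu> \<kappa> \<longleftrightarrow>
     0 < \<delta> \<and> 0 < \<nu> \<and> 0 < \<kappa> \<and> \<kappa> < 1 \<and>
     \<delta>\<^sup>2 = ((b - \<alpha>)\<^sup>2 + \<beta>\<^sup>2) / ((a - \<alpha>)\<^sup>2 + \<beta>\<^sup>2) \<and>
     \<nu>\<^sup>2 = sqrt (((a - \<alpha>)\<^sup>2 + \<beta>\<^sup>2) * ((b - \<alpha>)\<^sup>2 + \<beta>\<^sup>2)) \<and>
     2 * \<kappa>\<^sup>2 = 1 - ((a - \<alpha>) * (b - \<alpha>) + \<beta>\<^sup>2) /
                     sqrt (((a - \<alpha>)\<^sup>2 + \<beta>\<^sup>2) * ((b - \<alpha>)\<^sup>2 + \<beta>\<^sup>2))"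

text \<open>
  All roots of \<open>P\<close> are real, and \<open>uA\<close> is form (A). The solutions \<open>uS1\<close>, \<open>uS2\<close>, \<open>uS3\<close> result from
  \<open>u1 \<leftrightarrow> u2, u3 \<leftrightarrow> u4\<close>; \<open>u1 \<leftrightarrow> u3, u2 \<leftrightarrow> u4\<close>; and \<open>u1 \<leftrightarrow> u4, u2 \<leftrightarrow> u3\<close>. Solutions with values in
  \<open>[u2, u1]\<close> form one orbit under translation, represented by both \<open>uA\<close> and \<open>uS1\<close>; those with
  values in \<open>[u4, u3]\<close> form another one, represented by both \<open>uS2\<close> and \<open>uS3\<close>.
\<close>

definition solutions_of_form_A :: "real \<Rightarrow> real \<Rightarrow> real \<Rightarrow> bool" where
  "solutions_of_form_A c d e \<longleftrightarrow>
     (\<exists>u1 u2 u3 u4 \<nu> \<kappa> T uA uS1 uS2 uS3.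
        u4 \<le> u3 \<and> u3 \<le> u2 \<and> u2 \<le> u1 \<and>
        proots (mkdv_P c d e) = {#u1, u2, u3, u4#} \<and>
        params_A u1 u2 u3 u4 \<nu> \<kappa> \<and> uA = form_A u1 u2 u3 u4 \<nu> \<kappa> \<and>
        params_A u2 u1 u4 u3 \<nu> \<kappa> \<and> uS1 = form_A u2 u1 u4 u3 \<nu> \<kappa> \<and>
        params_A u3 u4 u1 u2 \<nu> \<kappa> \<and> uS2 = form_A u3 u4 u1 u2 \<nu> \<kappa> \<and>
        params_A u4 u3 u2 u1 \<nu> \<kappa> \<and> uS3 = form_A u4 u3 u2 u1 \<nu> \<kappa> \<and>
        distinct [uA, uS1, uS2, uS3] \<and>
        (\<forall>u \<in> {uA, uS1, uS2, uS3}. mkdv_solution c d e u \<and> fundamental_period u T) \<and>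
        (\<forall>v. mkdv_solution c d e v \<longrightarrow>
           (translate_of v uA \<and> translate_of v uS1) \<or>
           (translate_of v uS2 \<and> translate_of v uS3)))"

text \<open>
  \<open>P\<close> has the real roots \<open>b \<le> a\<close> and a pair of non-real roots \<open>\<alpha> \<plusminus> i\<beta>\<close>; \<open>uB\<close> is form (B) and \<open>uS0\<close>
  results from it by \<open>a \<leftrightarrow> b\<close>.
\<close>

definition solutions_of_form_B :: "real \<Rightarrow> real \<Rightarrow> real \<Rightarrow> bool" where
  "solutions_of_form_B c d e \<longleftrightarrow>
     (\<exists>a b \<alpha> \<beta> \<delta> \<nu> \<kappa> T uB uS0.
        b \<le> a \<and> \<beta> \<noteq> 0 \<and>
        proots (map_poly complex_of_real (mkdv_P c d e)) =
          {#complex_of_real a, complex_of_real b, Complex \<alpha> \<beta>, Complex \<alpha> (- \<beta>)#} \<and>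
        params_B a b \<alpha> \<beta> \<delta> \<nu> \<kappa> \<and> uB = form_B a b \<delta> \<nu> \<kappa> \<and>
        params_B b a \<alpha> \<beta> (inverse \<delta>) \<nu> \<kappa> \<and> uS0 = form_B b a (inverse \<delta>) \<nu> \<kappa> \<and>
        uB \<noteq> uS0 \<and>
        (\<forall>u \<in> {uB, uS0}. mkdv_solution c d e u \<and> fundamental_period u T) \<and>
        (\<forall>v. mkdv_solution c d e v \<longrightarrow> translate_of v uB \<and> translate_of v uS0))"

end

theory Submission
  imports Defs
begin

text \<open>
  Both formulas are Moebius functions \<open>\<phi>(S)\<close> of a function \<open>S\<close> (\<open>sn\<^sup>2\<close> for form (A), \<open>cn\<close> for
  form (B)) satisfying \<open>S'\<^sup>2 = G(S)\<close> and \<open>S'' = G'(S)/2\<close> with a polynomial \<open>G\<close>, and \<open>\<phi>\<close> carries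
  \<open>G\<close> to \<open>- P\<close>, which turns these equations into the given system. Conversely, a solution \<open>v\<close> has
  \<open>P(v) \<le> 0\<close>, so \<open>v(0)\<close> lies in the range of one of the explicit solutions, which are even and hence
  attain each value with both signs of the derivative; uniqueness for the initial value problem then
  makes \<open>v\<close> a translate. Since \<open>P\<close> depends on \<open>d\<close> only through its constant term, the number of real
  roots is read off from the critical values, and \<open>u \<mapsto> - u\<close> reduces everything to \<open>e \<ge> 0\<close>.
\<close>

subsection \<open>Jacobi elliptic functions\<close>


text \<open>The constants come from matching zeros. For form (A) the Moebius map sends 0, 1,
  1/\<kappa>^2 and infinity to \<open>u1\<close>, \<open>u2\<close>, \<open>u3\<close>,
  \<open>u4\<close>. Thus \<kappa>^2 is a cross-ratio of the roots, and (S1), (S2), (S3) are the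
  permutations that preserve cross-ratios. For form (B) the map sends 1 and -1 to \<open>a\<close>
  and \<open>b\<close>, and the remaining freedom \<delta> is fixed so that the factor with the
  non-real roots becomes even in cn. The obstacle is the turning points: the first-order equation
  alone also admits constants there, so uniqueness must use the second-order equation, whose
  nonlinearity is Lipschitz on the bounded set P \<le> 0. The thresholds for \<open>d\<close> are
  the negatives of the critical values of P taken with d = 0. For e = 0 the two minima of P are
  equally deep and the range between the last two thresholds is empty, hence the condition e
  \<noteq> 0 there.\<close>

definition jacobi_dn :: "real \<Rightarrow> real \<Rightarrow> real" where
  "jacobi_dn x \<kappa> = sqrt (1 - \<kappa>\<^sup>2 * (jacobi_sn x \<kappa>)\<^sup>2)"

context
  fixes \<kappa> :: real
  assumes \<kappa>: "0 < \<kappa>" "\<kappa> < 1"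
begin

lemma modulus_sin_less_1: "\<kappa>\<^sup>2 * (sin t)\<^sup>2 < 1"
proof -
  have "\<kappa>\<^sup>2 < 1" using \<kappa> by (simp add: power_less_one_iff)
  moreover have "\<kappa>\<^sup>2 * (sin t)\<^sup>2 \<le> \<kappa>\<^sup>2 * 1"
    by (intro mult_left_mono) (auto simp: abs_square_le_1)
  ultimately show ?thesis by simp
qed

lemma elliptic_F_0 [simp]: "elliptic_F 0 \<kappa> = 0"
  by (simp add: elliptic_F_def flip: zero_ereal_def)

lemma has_derivative_elliptic_F:
  "((\<lambda>t. elliptic_F t \<kappa>) has_real_derivative 1 / sqrt (1 - \<kappa>\<^sup>2 * (sin t)\<^sup>2)) (at t)"
proof -
  \<comment> \<open>The interval contains the lower limit 0 and has t in its interior, so the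
    derivative within it is a two-sided derivative.\<close>
  define a b where "a = min 0 t - 1" and "b = max 0 t + 1"
  have ab: "a < 0" "0 < b" "a < t" "t < b" by (auto simp: a_def b_def)
  have nz: "1 - \<kappa>\<^sup>2 * (sin x)\<^sup>2 \<noteq> 0" for x using modulus_sin_less_1[of x] by linarith
  have "continuous_on {a..b} (\<lambda>x. 1 / sqrt (1 - \<kappa>\<^sup>2 * (sin x)\<^sup>2))"
    using nz by (intro continuous_intros) auto
  then have "((\<lambda>u. LBINT y=0..u. 1 / sqrt (1 - \<kappa>\<^sup>2 * (sin y)\<^sup>2)) has_vector_derivative
      1 / sqrt (1 - \<kappa>\<^sup>2 * (sin t)\<^sup>2)) (at t within {a..b})"
    using interval_integral_FTC2[of a 0 b "\<lambda>x. 1 / sqrt (1 - \<kappa>\<^sup>2 * (sin x)\<^sup>2)" t] ab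
    by (simp add: zero_ereal_def)
  then show ?thesis
    using ab by (simp add: elliptic_F_def has_real_derivative_iff_has_vector_derivative
      at_within_interior[of t "{a..b}"])
qed

text \<open>The integrand is at least 1. This one estimate yields injectivity, surjectivity and the
  Lipschitz bound for the amplitude.\<close>

lemma elliptic_F_diff_ge:
  assumes "x \<le> y"
  shows "elliptic_F y \<kappa> - elliptic_F x \<kappa> \<ge> y - x"
proof -
  have "elliptic_F x \<kappa> - x \<le> elliptic_F y \<kappa> - y"
  proof (rule DERIV_nonneg_imp_nondecreasing[OF assms])
    fix t
    have "((\<lambda>x. elliptic_F x \<kappa> - x) has_real_derivative
        1 / sqrt (1 - \<kappa>\<^sup>2 * (sin t)\<^sup>2) - 1) (at t)"
      by (intro derivative_intros has_derivative_elliptic_F)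
    moreover have "1 / sqrt (1 - \<kappa>\<^sup>2 * (sin t)\<^sup>2) - 1 \<ge> 0"
      using modulus_sin_less_1[of t] by (simp add: divide_simps)
    ultimately show "\<exists>y. ((\<lambda>x. elliptic_F x \<kappa> - x) has_real_derivative y) (at t) \<and> y \<ge> 0"
      by blast
  qed
  then show ?thesis by simp
qed

lemma strict_mono_elliptic_F: "strict_mono (\<lambda>t. elliptic_F t \<kappa>)"
proof (rule strict_monoI)
  fix x y :: real assume "x < y"
  then show "elliptic_F x \<kappa> < elliptic_F y \<kappa>" using elliptic_F_diff_ge[of x y] by simp
qed

text \<open>\<open>jacobi_am\<close> is defined through \<open>inv\<close>, which is meaningful only
  for a bijection.\<close>

lemma bij_elliptic_F: "bij (\<lambda>t. elliptic_F t \<kappa>)"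
proof (rule bijI)
  show "inj (\<lambda>t. elliptic_F t \<kappa>)" by (rule strict_mono_imp_inj_on[OF strict_mono_elliptic_F])
  show "surj (\<lambda>t. elliptic_F t \<kappa>)"
  proof (rule surjI[of _ "\<lambda>y. SOME t. elliptic_F t \<kappa> = y"], rule someI_ex)
    fix y :: real
    have "elliptic_F (- \<bar>y\<bar>) \<kappa> \<le> y" "y \<le> elliptic_F \<bar>y\<bar> \<kappa>"
      using elliptic_F_diff_ge[of 0 "\<bar>y\<bar>"] elliptic_F_diff_ge[of "- \<bar>y\<bar>" 0] by simp_all
    then show "\<exists>t. elliptic_F t \<kappa> = y"
      using IVT'[of "\<lambda>t. elliptic_F t \<kappa>" "- \<bar>y\<bar>" y "\<bar>y\<bar>"]
        DERIV_continuous_on[of "{- \<bar>y\<bar>..\<bar>y\<bar>}" "\<lambda>t. elliptic_F t \<kappa>",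
          OF has_field_derivative_at_within[OF has_derivative_elliptic_F]]
      by auto
  qed
qed

lemma elliptic_F_minus: "elliptic_F (- t) \<kappa> = - elliptic_F t \<kappa>"
proof -
  have "((\<lambda>t. elliptic_F t \<kappa> + elliptic_F (- t) \<kappa>) has_real_derivative 0) (at x)" for x
    by (auto intro!: derivative_eq_intros has_derivative_elliptic_F
      DERIV_chain2[where f = "\<lambda>t. elliptic_F t \<kappa>"])
  from DERIV_isconst_all[OF allI[OF this], of t 0] show ?thesis by simp
qed

text \<open>The integrand has period \<pi>, so the difference of the two sides is constant. The
  increment \<open>elliptic_F pi \<kappa>\<close> is 2K, with K the complete integral: half the
  period of sn and cn.\<close>

lemma elliptic_F_add_pi: "elliptic_F (t + pi) \<kappa> = elliptic_F t \<kappa> + elliptic_F pi \<kappa>"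
proof -
  have "((\<lambda>t. elliptic_F (t + pi) \<kappa> - elliptic_F t \<kappa>) has_real_derivative 0) (at x)" for x
    by (auto intro!: derivative_eq_intros has_derivative_elliptic_F
      DERIV_chain2[where f = "\<lambda>t. elliptic_F t \<kappa>"])
  from DERIV_isconst_all[OF allI[OF this], of t 0] show ?thesis by simp
qed

lemma jacobi_am_elliptic_F [simp]: "jacobi_am (elliptic_F t \<kappa>) \<kappa> = t"
  unfolding jacobi_am_def using inv_f_f[OF bij_is_inj[OF bij_elliptic_F]] .

lemma elliptic_F_jacobi_am [simp]: "elliptic_F (jacobi_am x \<kappa>) \<kappa> = x"
  using bij_elliptic_F unfolding jacobi_am_def
  by (metis bij_inv_eq_iff)

lemma jacobi_am_less_iff: "jacobi_am x \<kappa> < jacobi_am y \<kappa> \<longleftrightarrow> x < y"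
  using strict_mono_less[OF strict_mono_elliptic_F, of "jacobi_am x \<kappa>" "jacobi_am y \<kappa>"] by simp

lemma jacobi_am_0 [simp]: "jacobi_am 0 \<kappa> = 0"
  using jacobi_am_elliptic_F[of 0] by (simp del: jacobi_am_elliptic_F)

lemma jacobi_am_minus: "jacobi_am (- x) \<kappa> = - jacobi_am x \<kappa>"
  by (metis elliptic_F_jacobi_am elliptic_F_minus jacobi_am_elliptic_F)

lemma jacobi_am_add: "jacobi_am (x + elliptic_F pi \<kappa>) \<kappa> = jacobi_am x \<kappa> + pi"
  by (metis elliptic_F_add_pi elliptic_F_jacobi_am jacobi_am_elliptic_F)

lemma has_derivative_jacobi_am:
  "((\<lambda>x. jacobi_am x \<kappa>) has_real_derivative sqrt (1 - \<kappa>\<^sup>2 * (jacobi_sn x \<kappa>)\<^sup>2)) (at x)"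
proof -
  \<comment> \<open>The inverse of the amplitude expands distances, so the amplitude is 1-Lipschitz;
    this gives the continuity that the inverse function rule requires.\<close>
  have lip: "\<bar>jacobi_am x \<kappa> - jacobi_am y \<kappa>\<bar> \<le> \<bar>x - y\<bar>" for x y
    using elliptic_F_diff_ge[of "jacobi_am x \<kappa>" "jacobi_am y \<kappa>"]
      elliptic_F_diff_ge[of "jacobi_am y \<kappa>" "jacobi_am x \<kappa>"] by simp linarith
  have "isCont (\<lambda>x. jacobi_am x \<kappa>) x"
    unfolding continuous_at_eps_delta
    using lip by (metis abs_minus_commute dist_real_def le_less_trans)
  then have "((\<lambda>x. jacobi_am x \<kappa>) has_real_derivative
      inverse (1 / sqrt (1 - \<kappa>\<^sup>2 * (sin (jacobi_am x \<kappa>))\<^sup>2))) (at x)"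
    using modulus_sin_less_1[of "jacobi_am x \<kappa>"]
    by (intro DERIV_inverse_function[where f = "\<lambda>t. elliptic_F t \<kappa>" and a = "x - 1" and b = "x + 1"]
      has_derivative_elliptic_F) auto
  then show ?thesis by (simp add: jacobi_sn_def)
qed

lemma sn_squared_plus_cn_squared: "(jacobi_sn x \<kappa>)\<^sup>2 + (jacobi_cn x \<kappa>)\<^sup>2 = 1"
  by (simp add: jacobi_sn_def jacobi_cn_def)

lemma dn_squared: "(jacobi_dn x \<kappa>)\<^sup>2 = 1 - \<kappa>\<^sup>2 * (jacobi_sn x \<kappa>)\<^sup>2"
  using modulus_sin_less_1[of "jacobi_am x \<kappa>"] by (simp add: jacobi_dn_def jacobi_sn_def)

lemma has_derivative_jacobi_sn:
  "((\<lambda>x. jacobi_sn x \<kappa>) has_real_derivative jacobi_cn x \<kappa> * jacobi_dn x \<kappa>) (at x)"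
  unfolding jacobi_sn_def jacobi_cn_def jacobi_dn_def
  using has_derivative_jacobi_am unfolding jacobi_sn_def
  by (auto intro!: derivative_eq_intros)

lemma has_derivative_jacobi_cn:
  "((\<lambda>x. jacobi_cn x \<kappa>) has_real_derivative - (jacobi_sn x \<kappa> * jacobi_dn x \<kappa>)) (at x)"
  unfolding jacobi_sn_def jacobi_cn_def jacobi_dn_def
  using has_derivative_jacobi_am unfolding jacobi_sn_def
  by (auto intro!: derivative_eq_intros)

lemma has_derivative_jacobi_dn:
  "((\<lambda>x. jacobi_dn x \<kappa>) has_real_derivative - (\<kappa>\<^sup>2 * jacobi_sn x \<kappa> * jacobi_cn x \<kappa>)) (at x)"
proof -
  have "1 - \<kappa>\<^sup>2 * (jacobi_sn x \<kappa>)\<^sup>2 > 0"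
    using modulus_sin_less_1[of "jacobi_am x \<kappa>"] by (simp add: jacobi_sn_def)
  then show ?thesis
    unfolding jacobi_dn_def
    by (auto intro!: derivative_eq_intros has_derivative_jacobi_sn
      simp: jacobi_dn_def field_simps)
qed

lemma elliptic_F_pos: "elliptic_F t \<kappa> > 0" if "t > 0"
  using elliptic_F_diff_ge[of 0 t] that by simp

lemma jacobi_sn_add: "jacobi_sn (x + elliptic_F pi \<kappa>) \<kappa> = - jacobi_sn x \<kappa>"
  by (simp add: jacobi_sn_def jacobi_am_add)

lemma jacobi_cn_add: "jacobi_cn (x + elliptic_F pi \<kappa>) \<kappa> = - jacobi_cn x \<kappa>"
  by (simp add: jacobi_cn_def jacobi_am_add)

lemma jacobi_am_bounds:
  assumes "0 < x" "x < elliptic_F t \<kappa>"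
  shows "0 < jacobi_am x \<kappa>" "jacobi_am x \<kappa> < t"
  using assms jacobi_am_less_iff[of 0 x] jacobi_am_less_iff[of x "elliptic_F t \<kappa>"]
  by simp_all

lemma jacobi_sn_nonzero:
  assumes "0 < x" "x < elliptic_F pi \<kappa>"
  shows "jacobi_sn x \<kappa> \<noteq> 0"
  using sin_gt_zero[OF jacobi_am_bounds[OF assms]] by (simp add: jacobi_sn_def)

text \<open>cn is 1 only where the amplitude is a multiple of 2\<pi>. This excludes periods of form
  (B) that are shorter than 4K/\<nu>.\<close>

lemma jacobi_cn_not_1:
  assumes "0 < x" "x < 2 * elliptic_F pi \<kappa>"
  shows "jacobi_cn x \<kappa> \<noteq> 1"
proof
  assume "jacobi_cn x \<kappa> = 1"
  then have "cos (jacobi_am x \<kappa>) = 1" by (simp add: jacobi_cn_def)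
  moreover have "elliptic_F (2 * pi) \<kappa> = 2 * elliptic_F pi \<kappa>"
    using elliptic_F_add_pi[of pi] unfolding mult_2 .
  then have "0 < jacobi_am x \<kappa>" "jacobi_am x \<kappa> < 2 * pi"
    using jacobi_am_bounds[of x "2 * pi"] assms by auto
  ultimately obtain n :: int where "0 < of_int n * (2 * pi)" "of_int n * (2 * pi) < 1 * (2 * pi)"
    unfolding cos_one_2pi_int by (auto simp: mult.assoc)
  then have "0 < n" "n < 1" unfolding mult_less_cancel_right by (auto simp: zero_less_mult_iff)
  then show False by simp
qed

end

subsection \<open>Solutions of the system\<close>


lemma mkdv_solutionI:
  assumes "\<And>x. (u has_real_derivative u1 x) (at x)"
    and "\<And>x. (u1 has_real_derivative u2 x) (at x)"
    and "\<And>x. u2 x = e + c * u x - 2 * u x ^ 3"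
    and "\<And>x. (u1 x)\<^sup>2 = - poly (mkdv_P c d e) (u x)"
  shows "mkdv_solution c d e u"
proof -
  have "deriv u = u1" "deriv u1 = u2"
    using assms(1,2) by (auto intro!: ext DERIV_imp_deriv)
  then show ?thesis
    using assms unfolding mkdv_solution_def
    by (auto simp: poly_mkdv_P real_differentiable_def algebra_simps)
qed

lemma mkdv_solutionD:
  assumes "mkdv_solution c d e u"
  shows "(u has_real_derivative deriv u x) (at x)"
    and "(deriv u has_real_derivative e + c * u x - 2 * u x ^ 3) (at x)"
    and "(deriv u x)\<^sup>2 = - poly (mkdv_P c d e) (u x)"
proof -
  note a = assms[unfolded mkdv_solution_def]
  show "(u has_real_derivative deriv u x) (at x)"
    using a by (simp add: DERIV_deriv_iff_real_differentiable)
  have "deriv (deriv u) x = e + c * u x - 2 * u x ^ 3"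
    using a by (simp add: algebra_simps)
  then show "(deriv u has_real_derivative e + c * u x - 2 * u x ^ 3) (at x)"
    using a by (metis DERIV_deriv_iff_real_differentiable)
  show "(deriv u x)\<^sup>2 = - poly (mkdv_P c d e) (u x)"
    using spec[OF conjunct2[OF conjunct2[OF conjunct2[OF a]]], of x]
    by (simp add: poly_mkdv_P algebra_simps)
qed

lemma mkdv_solution_shift:
  assumes "mkdv_solution c d e u"
  shows "mkdv_solution c d e (\<lambda>x. u (x + x0))"
  by (rule mkdv_solutionI[where ?u1.0 = "\<lambda>x. deriv u (x + x0)"])
    (auto simp: mkdv_solutionD[OF assms] simp flip: DERIV_shift)

section \<open>A priori bound and uniqueness for the initial value problem\<close>

text \<open>The lower-order terms sum to at most (|u| - 1) u^2, which u^4 dominates. The bound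
  confines all solutions, since P = -u'^2 \<le> 0 along them, and later supplies outer points of
  positive sign for isolating roots.\<close>

lemma poly_mkdv_P_pos:
  assumes "\<bar>u\<bar> \<ge> 1 + \<bar>c\<bar> + \<bar>d\<bar> + 2 * \<bar>e\<bar>"
  shows "poly (mkdv_P c d e) u > 0"
proof -
  define t where "t = \<bar>u\<bar>"
  have t: "t \<ge> 1" "\<bar>c\<bar> + \<bar>d\<bar> + 2 * \<bar>e\<bar> \<le> t - 1" using assms by (auto simp: t_def)
  have t2: "1 \<le> t\<^sup>2" "t \<le> t\<^sup>2" "t\<^sup>2 \<le> t ^ 3"
    using t by (auto simp: power2_eq_square power3_eq_cube intro: mult_mono' order_trans[of _ "t * 1"])
  have "c * u\<^sup>2 \<le> \<bar>c\<bar> * t\<^sup>2" by (simp add: t_def mult_right_mono)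
  moreover have "- d \<le> \<bar>d\<bar> * t\<^sup>2" using mult_left_mono[OF t2(1), of "\<bar>d\<bar>"] by simp
  moreover have "e * u \<le> \<bar>e\<bar> * t\<^sup>2"
    using mult_left_mono[OF t2(2), of "\<bar>e\<bar>"] abs_ge_self[of "e * u"]
    by (simp add: t_def abs_mult)
  ultimately have "c * u\<^sup>2 - d + 2 * e * u \<le> (\<bar>c\<bar> + \<bar>d\<bar> + 2 * \<bar>e\<bar>) * t\<^sup>2"
    by (simp add: algebra_simps)
  also have "\<dots> \<le> (t - 1) * t\<^sup>2" using t(2) by (simp add: mult_right_mono)
  also have "\<dots> \<le> (t - 1) * t ^ 3" using t t2 by (simp add: mult_left_mono)
  also have "\<dots> < t ^ 4" using t by (simp add: algebra_simps eval_nat_numeral)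
  finally show ?thesis by (simp add: poly_mkdv_P t_def)
qed

text \<open>Gronwall's inequality in both directions: E exp(-Mx) is nonincreasing to the right of 0,
  and E exp(Mx) is nondecreasing to the left of it.\<close>

lemma zero_if_deriv_bounded:
  fixes E :: "real \<Rightarrow> real"
  assumes der: "\<And>x. (E has_real_derivative E' x) (at x)"
    and bound: "\<And>x. \<bar>E' x\<bar> \<le> M * E x" and nonneg: "\<And>x. E x \<ge> 0" and zero: "E 0 = 0"
  shows "E x = 0"
proof -
  have "E x \<le> 0"
  proof (cases "x \<ge> 0")
    case True
    have "E x * exp (- M * x) \<le> E 0 * exp (- M * 0)"
    proof (rule DERIV_nonpos_imp_nonincreasing[OF True])
      fix t
      have "((\<lambda>x. E x * exp (- M * x)) has_real_derivative (E' t - M * E t) * exp (- M * t)) (at t)"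
        by (auto intro!: derivative_eq_intros der simp: algebra_simps)
      moreover have "(E' t - M * E t) * exp (- M * t) \<le> 0"
        using bound[of t] by (simp add: mult_le_0_iff)
      ultimately show "\<exists>y. ((\<lambda>x. E x * exp (- M * x)) has_real_derivative y) (at t) \<and> y \<le> 0"
        by blast
    qed
    then show ?thesis by (simp add: zero mult_le_0_iff)
  next
    case False
    then have "x \<le> 0" by simp
    have "E x * exp (M * x) \<le> E 0 * exp (M * 0)"
    proof (rule DERIV_nonneg_imp_nondecreasing[OF \<open>x \<le> 0\<close>])
      fix t
      have "((\<lambda>x. E x * exp (M * x)) has_real_derivative (E' t + M * E t) * exp (M * t)) (at t)"
        by (auto intro!: derivative_eq_intros der simp: algebra_simps)
      moreover have "(E' t + M * E t) * exp (M * t) \<ge> 0"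
        using bound[of t] by (simp add: zero_le_mult_iff)
      ultimately show "\<exists>y. ((\<lambda>x. E x * exp (M * x)) has_real_derivative y) (at t) \<and> y \<ge> 0"
        by blast
    qed
    then show ?thesis by (simp add: zero mult_le_0_iff)
  qed
  with nonneg[of x] show ?thesis by simp
qed

text \<open>The cubic right-hand side is not globally Lipschitz, but the energy equation keeps both
  solutions in [-R, R], where it is.\<close>

lemma mkdv_solution_unique:
  assumes v: "mkdv_solution c d e v" and w: "mkdv_solution c d e w"
    and init: "v 0 = w 0" "deriv v 0 = deriv w 0"
  shows "v = w"
proof
  fix x
  define R where "R = 1 + \<bar>c\<bar> + \<bar>d\<bar> + 2 * \<bar>e\<bar>"
  have R: "\<bar>u x\<bar> \<le> R" if "mkdv_solution c d e u" for u x
  proof (rule ccontr)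
    assume "\<not> \<bar>u x\<bar> \<le> R"
    then have "poly (mkdv_P c d e) (u x) > 0" by (intro poly_mkdv_P_pos) (simp add: R_def)
    then show False using mkdv_solutionD(3)[OF that, of x] zero_le_power2[of "deriv u x"] by linarith
  qed
  \<comment> \<open>The divided difference of u \<mapsto> e + c u - 2 u^3 between \<open>v x\<close>
    and \<open>w x\<close>, so that the second derivative of v - w is m (v - w).\<close>
  define m where "m x = c - 2 * ((v x)\<^sup>2 + v x * w x + (w x)\<^sup>2)" for x
  define L where "L = \<bar>c\<bar> + 6 * R\<^sup>2"
  have m: "\<bar>m x\<bar> \<le> L" for x
  proof -
    have "(v x)\<^sup>2 \<le> R\<^sup>2" "(w x)\<^sup>2 \<le> R\<^sup>2"
      using power_mono[OF R[OF v, of x], of 2] power_mono[OF R[OF w, of x], of 2] by simp_all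
    moreover have "\<bar>v x * w x\<bar> \<le> R\<^sup>2"
      using R[OF v, of x] R[OF w, of x] unfolding abs_mult power2_eq_square
      by (intro mult_mono) auto
    moreover have "0 \<le> (v x)\<^sup>2" "0 \<le> (w x)\<^sup>2" by simp_all
    ultimately have "\<bar>2 * ((v x)\<^sup>2 + v x * w x + (w x)\<^sup>2)\<bar> \<le> 6 * R\<^sup>2"
      by argo
    then show ?thesis
      unfolding m_def L_def
      using abs_triangle_ineq4[of c "2 * ((v x)\<^sup>2 + v x * w x + (w x)\<^sup>2)"] by linarith
  qed
  \<comment> \<open>Squared distance of the two solutions in the phase plane.\<close>
  define E where "E x = (v x - w x)\<^sup>2 + (deriv v x - deriv w x)\<^sup>2" for x
  define E' where "E' x = 2 * ((v x - w x) * (deriv v x - deriv w x)) * (1 + m x)" for x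
  have "(E has_real_derivative E' x) (at x)" for x
    unfolding E_def
    by (rule derivative_eq_intros mkdv_solutionD(1,2)[OF v] mkdv_solutionD(1,2)[OF w] refl)+
      (simp add: E'_def m_def algebra_simps power2_eq_square power3_eq_cube)
  moreover have "\<bar>E' x\<bar> \<le> (1 + L) * E x" for x
  proof -
    have "2 * \<bar>(v x - w x) * (deriv v x - deriv w x)\<bar> \<le> E x"
      using sum_squares_bound[of "\<bar>v x - w x\<bar>" "\<bar>deriv v x - deriv w x\<bar>"]
      by (simp add: E_def abs_mult mult.assoc)
    moreover have "\<bar>1 + m x\<bar> \<le> 1 + L" using m[of x] by linarith
    ultimately have "(2 * \<bar>(v x - w x) * (deriv v x - deriv w x)\<bar>) * \<bar>1 + m x\<bar> \<le> E x * (1 + L)"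
      by (intro mult_mono) (auto simp: E_def)
    then show ?thesis by (simp add: E'_def abs_mult ac_simps)
  qed
  moreover have "E x \<ge> 0" for x by (simp add: E_def)
  moreover have "E 0 = 0" using init by (simp add: E_def)
  ultimately have "E x = 0" by (rule zero_if_deriv_bounded)
  then show "v x = w x" by (simp add: E_def sum_power2_eq_zero_iff)
qed

text \<open>\<open>T\<close> only has to be a time at which the other end of the range is reached;
  both applications take half the fundamental period. As \<open>closed_segment\<close> ignores the
  order of its ends, solutions that start at their minimum are covered too.\<close>

lemma translate_of_even_solution:
  assumes u: "mkdv_solution c d e u" and v: "mkdv_solution c d e v"
    and even: "\<And>x. u (- x) = u x" and range: "v 0 \<in> closed_segment (u 0) (u T)"
  shows "translate_of v u"
proof -
  have "continuous_on (closed_segment 0 T) u"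
    using mkdv_solutionD(1)[OF u] by (meson DERIV_isCont continuous_at_imp_continuous_on)
  then have "closed_segment (u 0) (u T) \<subseteq> u ` closed_segment 0 T"
    by (intro subset_continuous_image_segment_1)
  with range obtain y where y: "u y = v 0" by auto
  have odd: "deriv u (- y) = - deriv u y" for y
  proof -
    have "((\<lambda>x. u (- x)) has_real_derivative - deriv u (- y)) (at y)"
      using mkdv_solutionD(1)[OF u, of "- y"] by (simp flip: DERIV_mirror)
    then have "(u has_real_derivative - deriv u (- y)) (at y)" by (simp only: even)
    from DERIV_unique[OF this mkdv_solutionD(1)[OF u]] show ?thesis by simp
  qed
  have "(deriv u y)\<^sup>2 = (deriv v 0)\<^sup>2"
    using mkdv_solutionD(3)[OF u, of y] mkdv_solutionD(3)[OF v, of 0] y by simp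
  then obtain x0 where x0: "u x0 = v 0" "deriv u x0 = deriv v 0"
    using y even[of y] odd[of y] by (metis power2_eq_iff add.inverse_inverse)
  have "deriv (\<lambda>x. u (x + x0)) 0 = deriv u x0"
    using mkdv_solutionD(1)[OF u, of x0] by (intro DERIV_imp_deriv) (simp flip: DERIV_shift)
  then have "v = (\<lambda>x. u (x + x0))"
    using x0 by (intro mkdv_solution_unique[OF v mkdv_solution_shift[OF u]]) auto
  then show ?thesis unfolding translate_of_def by blast
qed

text \<open>Differentiating the energy identity with respect to \<open>s\<close> and cancelling \<open>\<phi>'(s)\<close> gives the
  second-order equation also at the turning points of \<open>\<phi> \<circ> S\<close>.\<close>

lemma mkdv_solution_moebius:
  fixes p q r t :: real
  defines "\<phi> \<equiv> \<lambda>s. (p + q * s) / (r + t * s)"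
  assumes nondeg: "q * r - p * t \<noteq> 0"
    and S: "\<And>x. (S has_real_derivative S1 x) (at x)"
      "\<And>x. (S1 has_real_derivative G1 (S x) / 2) (at x)" "\<And>x. (S1 x)\<^sup>2 = G (S x)"
    and G: "\<And>s. (G has_real_derivative G1 s) (at s)"
    and D: "\<And>x. r + t * S x \<noteq> 0"
    and energy: "\<And>s. r + t * s \<noteq> 0 \<Longrightarrow>
      (q * r - p * t)\<^sup>2 * G s = - poly (mkdv_P c d e) (\<phi> s) * (r + t * s) ^ 4"
  shows "mkdv_solution c d e (\<lambda>x. \<phi> (S x))"
proof -
  define \<phi>1 where "\<phi>1 s = (q * r - p * t) / (r + t * s)\<^sup>2" for s
  define \<phi>2 where "\<phi>2 s = - 2 * t * (q * r - p * t) / (r + t * s) ^ 3" for s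
  have d1: "(\<phi> has_real_derivative \<phi>1 s) (at s)" if "r + t * s \<noteq> 0" for s
    unfolding \<phi>_def \<phi>1_def
    by (rule DERIV_cong, (rule derivative_intros that)+)
      (use that in \<open>simp add: divide_simps power2_eq_square, simp add: algebra_simps\<close>)
  have d2: "(\<phi>1 has_real_derivative \<phi>2 s) (at s)" if "r + t * s \<noteq> 0" for s
    unfolding \<phi>1_def \<phi>2_def
    by (rule DERIV_cong, (rule derivative_intros power_not_zero that)+)
      (use that in \<open>simp add: divide_simps eval_nat_numeral\<close>)
  have en: "(\<phi>1 s)\<^sup>2 * G s = - poly (mkdv_P c d e) (\<phi> s)" if "r + t * s \<noteq> 0" for s
    using energy[OF that] that by (simp add: \<phi>1_def power_divide divide_simps)
  have acc: "\<phi>2 s * G s + \<phi>1 s * G1 s / 2 = e + c * \<phi> s - 2 * \<phi> s ^ 3" if "r + t * s \<noteq> 0" for s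
  proof -
    have "((\<lambda>s. (\<phi>1 s)\<^sup>2 * G s) has_real_derivative
        2 * \<phi>1 s * \<phi>2 s * G s + (\<phi>1 s)\<^sup>2 * G1 s) (at s)"
      by (rule DERIV_cong, (rule derivative_intros d2 that G)+) (simp add: power2_eq_square)
    moreover have "((\<lambda>s. - poly (mkdv_P c d e) (\<phi> s)) has_real_derivative
        - (4 * \<phi> s ^ 3 - 2 * c * \<phi> s - 2 * e) * \<phi>1 s) (at s)"
      unfolding poly_mkdv_P
      by (rule DERIV_cong, (rule derivative_intros d1 that)+) (simp add: algebra_simps)
    then have "((\<lambda>s. (\<phi>1 s)\<^sup>2 * G s) has_real_derivative
        - (4 * \<phi> s ^ 3 - 2 * c * \<phi> s - 2 * e) * \<phi>1 s) (at s)"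
      \<comment> \<open>The energy identity holds only off the pole of \<phi>, but that set is open,
        so the derivatives agree as well.\<close>
      by (rule has_field_derivative_transform_within_open[where S = "{s. r + t * s \<noteq> 0}"])
        (use that en in \<open>auto intro!: open_Collect_neq continuous_intros\<close>)
    ultimately have "2 * \<phi>1 s * \<phi>2 s * G s + (\<phi>1 s)\<^sup>2 * G1 s
        = - (4 * \<phi> s ^ 3 - 2 * c * \<phi> s - 2 * e) * \<phi>1 s"
      by (rule DERIV_unique)
    then have "\<phi>1 s * (2 * (\<phi>2 s * G s + \<phi>1 s * G1 s / 2))
        = \<phi>1 s * (2 * (e + c * \<phi> s - 2 * \<phi> s ^ 3))"
      by (simp add: algebra_simps power2_eq_square)
    moreover have "\<phi>1 s \<noteq> 0" using nondeg that by (simp add: \<phi>1_def)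
    ultimately show ?thesis by simp
  qed
  show ?thesis
  proof (rule mkdv_solutionI)
    fix x
    show "((\<lambda>x. \<phi> (S x)) has_real_derivative \<phi>1 (S x) * S1 x) (at x)"
      by (rule DERIV_chain2[OF d1 S(1)]) (rule D)
    show "((\<lambda>x. \<phi>1 (S x) * S1 x) has_real_derivative
        \<phi>2 (S x) * (S1 x)\<^sup>2 + \<phi>1 (S x) * G1 (S x) / 2) (at x)"
      by (rule DERIV_cong, (rule DERIV_mult DERIV_chain2[OF d2 S(1)] D S(2))+)
        (simp add: power2_eq_square)
    show "\<phi>2 (S x) * (S1 x)\<^sup>2 + \<phi>1 (S x) * G1 (S x) / 2
        = e + c * \<phi> (S x) - 2 * \<phi> (S x) ^ 3"
      using acc[OF D] by (simp add: S(3))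
    show "(\<phi>1 (S x) * S1 x)\<^sup>2 = - poly (mkdv_P c d e) (\<phi> (S x))"
      using en[OF D] by (simp add: power_mult_distrib S(3))
  qed
qed

section \<open>Forms (A) and (B) as periodic solutions\<close>

text \<open>A smaller period would repeat the value at 0 too early. In both forms that value is an
  extremum of the solution, taken once per period.\<close>

lemma fundamental_periodI:
  assumes "0 < T" "\<And>x. u (x + T) = u x" "\<And>S. 0 < S \<Longrightarrow> S < T \<Longrightarrow> u S \<noteq> u 0"
  shows "fundamental_period u T"
proof -
  have "\<not> periodic_fun_simple u S" if "0 < S" "S < T" for S
    using assms(3)[OF that] periodic_fun_simple.plus_period[of u S 0] by auto
  with assms show ?thesis unfolding fundamental_period_def periodic_fun_simple_def by blast
qed

lemma form_A_moebius:
  assumes "u1 \<noteq> u4" "u2 \<noteq> u4" "(u2 - u4) + (u1 - u2) * (jacobi_sn (\<nu> * x) \<kappa>)\<^sup>2 \<noteq> 0"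
  shows "form_A u1 u2 u3 u4 \<nu> \<kappa> x = (u1 * (u2 - u4) + u4 * (u1 - u2) * (jacobi_sn (\<nu> * x) \<kappa>)\<^sup>2) /
     ((u2 - u4) + (u1 - u2) * (jacobi_sn (\<nu> * x) \<kappa>)\<^sup>2)"
  using assms by (simp add: form_A_def divide_simps) (simp add: algebra_simps)

text \<open>A convex combination of two numbers of equal sign; multiplying it by \<open>p\<close>
  treats both signs at once.\<close>

lemma affine_between_nonzero:
  fixes p q s :: real
  assumes "0 < p * q" "0 \<le> s" "s \<le> 1"
  shows "p + (q - p) * s \<noteq> 0"
proof -
  have "p + (q - p) * s = p * (1 - s) + q * s" by (simp add: algebra_simps)
  moreover have "p * (p * (1 - s) + q * s) > 0"
  proof (cases "s = 0")
    case True then show ?thesis using assms by (auto simp: zero_less_mult_iff)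
  next
    case False
    have "p * (p * (1 - s) + q * s) = p\<^sup>2 * (1 - s) + (p * q) * s"
      by (simp add: algebra_simps power2_eq_square)
    moreover have "p\<^sup>2 * (1 - s) \<ge> 0" "(p * q) * s > 0" using assms False by auto
    ultimately show ?thesis by linarith
  qed
  ultimately show ?thesis by auto
qed

text \<open>No order of the roots is assumed: a common sign of \<open>u1 - u4\<close> and
  \<open>u2 - u4\<close> keeps the denominator away from 0. The same statement therefore serves form
  (A) and its three permutations.\<close>

lemma
  assumes par: "params_A u1 u2 u3 u4 \<nu> \<kappa>"
    and roots: "\<And>u. poly (mkdv_P c d e) u = (u - u1) * (u - u2) * (u - u3) * (u - u4)"
    and sep: "0 < (u1 - u4) * (u2 - u4)" "u1 \<noteq> u2"
  shows mkdv_solution_form_A: "mkdv_solution c d e (form_A u1 u2 u3 u4 \<nu> \<kappa>)"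
    and fundamental_period_form_A:
      "fundamental_period (form_A u1 u2 u3 u4 \<nu> \<kappa>) (elliptic_F pi \<kappa> / \<nu>)"
    and form_A_minus: "form_A u1 u2 u3 u4 \<nu> \<kappa> (- x) = form_A u1 u2 u3 u4 \<nu> \<kappa> x"
    and form_A_0: "form_A u1 u2 u3 u4 \<nu> \<kappa> 0 = u1"
    and form_A_half_period: "form_A u1 u2 u3 u4 \<nu> \<kappa> (elliptic_F (pi / 2) \<kappa> / \<nu>) = u2"
proof -
  have \<kappa>: "0 < \<kappa>" "\<kappa> < 1" and \<nu>: "\<nu> > 0"
    and A1: "4 * \<nu>\<^sup>2 = (u1 - u3) * (u2 - u4)"
    and A2: "4 * \<nu>\<^sup>2 * \<kappa>\<^sup>2 = (u1 - u2) * (u3 - u4)"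
    using par by (auto simp: params_A_def)
  define sn cn dn where "sn x = jacobi_sn x \<kappa>" and "cn x = jacobi_cn x \<kappa>" and "dn x = jacobi_dn x \<kappa>"
    for x
  note J = has_derivative_jacobi_sn[OF \<kappa>, folded sn_def cn_def dn_def]
    has_derivative_jacobi_cn[OF \<kappa>, folded sn_def cn_def dn_def]
    has_derivative_jacobi_dn[OF \<kappa>, folded sn_def cn_def dn_def]
  have sq: "(cn x)\<^sup>2 = 1 - (sn x)\<^sup>2" "(dn x)\<^sup>2 = 1 - \<kappa>\<^sup>2 * (sn x)\<^sup>2" for x
    using sn_squared_plus_cn_squared[OF \<kappa>, of x] dn_squared[OF \<kappa>, of x]
    by (simp_all add: sn_def cn_def dn_def)
  have "(u2 - u4) + (u1 - u2) * (sn x)\<^sup>2 \<noteq> 0" for x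
    using affine_between_nonzero[of "u2 - u4" "u1 - u4" "(sn x)\<^sup>2"] sep(1)
    by (simp add: sn_def jacobi_sn_def abs_square_le_1 mult.commute)
  note D = this
  have ne: "u1 \<noteq> u4" "u2 \<noteq> u4" using sep(1) by auto
  define S where "S x = (sn (\<nu> * x))\<^sup>2" for x
  define S1 where "S1 x = 2 * \<nu> * (sn (\<nu> * x) * cn (\<nu> * x) * dn (\<nu> * x))" for x
  define G where "G s = 4 * \<nu>\<^sup>2 * (s * (1 - s) * (1 - \<kappa>\<^sup>2 * s))" for s
  define G1 where
    "G1 s = 4 * \<nu>\<^sup>2 * ((1 - s) * (1 - \<kappa>\<^sup>2 * s) - s * (1 - \<kappa>\<^sup>2 * s) - \<kappa>\<^sup>2 * s * (1 - s))" for s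
  have scale: "((\<lambda>x. f (\<nu> * x)) has_real_derivative f' * \<nu>) (at x)"
    if "(f has_real_derivative f') (at (\<nu> * x))" for f f' x
    using DERIV_chain2[where f = f and g = "\<lambda>x. \<nu> * x", OF that] DERIV_cmult_Id by blast
  have "mkdv_solution c d e (\<lambda>x. (u1 * (u2 - u4) + u4 * (u1 - u2) * S x) /
      ((u2 - u4) + (u1 - u2) * S x))"
  proof (rule mkdv_solution_moebius)
    show "u4 * (u1 - u2) * (u2 - u4) - u1 * (u2 - u4) * (u1 - u2) \<noteq> 0"
    proof -
      have "u4 * (u1 - u2) * (u2 - u4) - u1 * (u2 - u4) * (u1 - u2)
        = - (u1 - u2) * (u2 - u4) * (u1 - u4)" by (simp add: algebra_simps)
      then show ?thesis using ne sep(2) by simp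
    qed
    show "(S has_real_derivative S1 x) (at x)" for x
      unfolding S_def
      by (rule DERIV_cong, (rule DERIV_power scale J)+)
        (simp add: S1_def algebra_simps)
    show "(S1 has_real_derivative G1 (S x) / 2) (at x)" for x
    proof -
      have "(S1 has_real_derivative 2 * \<nu> * (\<nu> * ((cn (\<nu> * x))\<^sup>2 * (dn (\<nu> * x))\<^sup>2 -
          (sn (\<nu> * x))\<^sup>2 * (dn (\<nu> * x))\<^sup>2 - \<kappa>\<^sup>2 * (sn (\<nu> * x))\<^sup>2 * (cn (\<nu> * x))\<^sup>2))) (at x)"
        unfolding S1_def
        by (rule DERIV_cong, (rule DERIV_cmult DERIV_mult scale J)+)
          (simp add: power2_eq_square algebra_simps)
      then show ?thesis
        unfolding sq S_def[symmetric] G1_def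
        by (rule DERIV_cong) (simp add: power2_eq_square mult.commute mult.left_commute)
    qed
    show "(S1 x)\<^sup>2 = G (S x)" for x
      by (simp add: S1_def G_def S_def power_mult_distrib sq)
    show "(G has_real_derivative G1 s) (at s)" for s
      unfolding G_def by (rule DERIV_cong, (rule derivative_intros)+) (simp add: G1_def algebra_simps)
    show "u2 - u4 + (u1 - u2) * S x \<noteq> 0" for x
      using D by (simp add: S_def)
    show "(u4 * (u1 - u2) * (u2 - u4) - u1 * (u2 - u4) * (u1 - u2))\<^sup>2 * G s =
        - poly (mkdv_P c d e) ((u1 * (u2 - u4) + u4 * (u1 - u2) * s) / (u2 - u4 + (u1 - u2) * s)) *
        (u2 - u4 + (u1 - u2) * s) ^ 4" if D: "u2 - u4 + (u1 - u2) * s \<noteq> 0" for s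
    proof -
      \<comment> \<open>Clearing the denominator \<open>E\<close> from each root factor separately
        leaves affine functions of \<open>s\<close> (a constant for \<open>u4\<close>), whose
        product is \<open>G s\<close> up to a constant.\<close>
      define E where "E = u2 - u4 + (u1 - u2) * s"
      define v where "v = (u1 * (u2 - u4) + u4 * (u1 - u2) * s) / E"
      have vE: "v * E = u1 * (u2 - u4) + u4 * (u1 - u2) * s" using D by (simp add: v_def flip: E_def)
      have "(v - u1) * E = - ((u1 - u4) * (u1 - u2) * s)"
        unfolding left_diff_distrib vE by (simp add: E_def algebra_simps)
      moreover have "(v - u2) * E = (u2 - u4) * (u1 - u2) * (1 - s)"
        unfolding left_diff_distrib vE by (simp add: E_def algebra_simps)
      moreover have "(v - u3) * E = 4 * \<nu>\<^sup>2 * (1 - \<kappa>\<^sup>2 * s)"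
      proof -
        have "4 * \<nu>\<^sup>2 * (1 - \<kappa>\<^sup>2 * s) = 4 * \<nu>\<^sup>2 - 4 * \<nu>\<^sup>2 * \<kappa>\<^sup>2 * s"
          by (simp add: algebra_simps)
        also have "\<dots> = (u1 - u3) * (u2 - u4) - (u1 - u2) * (u3 - u4) * s"
          using A1 A2 by simp
        also have "\<dots> = (v - u3) * E"
          unfolding left_diff_distrib vE by (simp add: E_def algebra_simps)
        finally show ?thesis by simp
      qed
      moreover have "(v - u4) * E = (u1 - u4) * (u2 - u4)"
        unfolding left_diff_distrib vE by (simp add: E_def algebra_simps)
      moreover have "poly (mkdv_P c d e) v * E ^ 4
          = ((v - u1) * E) * ((v - u2) * E) * ((v - u3) * E) * ((v - u4) * E)"
        by (simp add: roots power4_eq_xxxx ac_simps)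
      ultimately have "poly (mkdv_P c d e) v * E ^ 4
          = - ((u1 - u4) * (u1 - u2) * s) * ((u2 - u4) * (u1 - u2) * (1 - s)) *
            (4 * \<nu>\<^sup>2 * (1 - \<kappa>\<^sup>2 * s)) * ((u1 - u4) * (u2 - u4))" by simp
      moreover have "u4 * (u1 - u2) * (u2 - u4) - u1 * (u2 - u4) * (u1 - u2)
        = - ((u1 - u2) * (u2 - u4) * (u1 - u4))" by (simp add: algebra_simps)
      ultimately show ?thesis
        unfolding E_def[symmetric] v_def[symmetric] minus_mult_left[symmetric]
        by (simp add: G_def power2_eq_square ac_simps)
    qed
  qed
  also have "(\<lambda>x. (u1 * (u2 - u4) + u4 * (u1 - u2) * S x) / ((u2 - u4) + (u1 - u2) * S x))
      = form_A u1 u2 u3 u4 \<nu> \<kappa>"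
    using D ne by (intro ext, subst form_A_moebius) (auto simp: S_def sn_def)
  finally show "mkdv_solution c d e (form_A u1 u2 u3 u4 \<nu> \<kappa>)" .
  show zero: "form_A u1 u2 u3 u4 \<nu> \<kappa> 0 = u1"
    using ne by (simp add: form_A_def jacobi_sn_def \<kappa>)
  show "form_A u1 u2 u3 u4 \<nu> \<kappa> (- x) = form_A u1 u2 u3 u4 \<nu> \<kappa> x"
    by (simp add: form_A_def jacobi_sn_def jacobi_am_minus[OF \<kappa>])
  show "form_A u1 u2 u3 u4 \<nu> \<kappa> (elliptic_F (pi / 2) \<kappa> / \<nu>) = u2"
    using ne \<nu> by (simp add: form_A_def jacobi_sn_def \<kappa>)
  show "fundamental_period (form_A u1 u2 u3 u4 \<nu> \<kappa>) (elliptic_F pi \<kappa> / \<nu>)"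
  proof (rule fundamental_periodI)
    show "0 < elliptic_F pi \<kappa> / \<nu>" using \<nu> elliptic_F_pos[OF \<kappa>, of pi] by simp
    show "form_A u1 u2 u3 u4 \<nu> \<kappa> (x + elliptic_F pi \<kappa> / \<nu>) = form_A u1 u2 u3 u4 \<nu> \<kappa> x" for x
      using \<nu> by (simp add: form_A_def distrib_left jacobi_sn_add[OF \<kappa>])
    fix y assume y: "0 < y" "y < elliptic_F pi \<kappa> / \<nu>"
    then have "sn (\<nu> * y) \<noteq> 0"
      using \<nu> unfolding sn_def by (intro jacobi_sn_nonzero[OF \<kappa>]) (simp_all add: field_simps)
    moreover have "form_A u1 u2 u3 u4 \<nu> \<kappa> y - u1
        = - ((u1 - u4) * (u1 - u2) * (sn (\<nu> * y))\<^sup>2) / (u2 - u4 + (u1 - u2) * (sn (\<nu> * y))\<^sup>2)"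
      using D[of "\<nu> * y"] by (simp add: form_A_def divide_simps flip: sn_def) (simp add: algebra_simps)
    ultimately have "form_A u1 u2 u3 u4 \<nu> \<kappa> y - u1 \<noteq> 0"
      using D[of "\<nu> * y"] ne sep(2) by simp
    then show "form_A u1 u2 u3 u4 \<nu> \<kappa> y \<noteq> form_A u1 u2 u3 u4 \<nu> \<kappa> 0"
      unfolding zero by simp
  qed
qed


text \<open>Only \<open>a \<noteq> b\<close> is assumed, so that the image under (S0) is covered by
  the same statement.\<close>

lemma
  assumes par: "params_B a b \<alpha> \<beta> \<delta> \<nu> \<kappa>"
    and roots: "\<And>u. poly (mkdv_P c d e) u = (u - a) * (u - b) * ((u - \<alpha>)\<^sup>2 + \<beta>\<^sup>2)"
    and sep: "a \<noteq> b" "\<beta> \<noteq> 0"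
  shows mkdv_solution_form_B: "mkdv_solution c d e (form_B a b \<delta> \<nu> \<kappa>)"
    and fundamental_period_form_B:
      "fundamental_period (form_B a b \<delta> \<nu> \<kappa>) (2 * elliptic_F pi \<kappa> / \<nu>)"
    and form_B_minus: "form_B a b \<delta> \<nu> \<kappa> (- x) = form_B a b \<delta> \<nu> \<kappa> x"
    and form_B_0: "form_B a b \<delta> \<nu> \<kappa> 0 = a"
    and form_B_half_period: "form_B a b \<delta> \<nu> \<kappa> (elliptic_F pi \<kappa> / \<nu>) = b"
proof -
  define L M K where "L = (a - \<alpha>)\<^sup>2 + \<beta>\<^sup>2" and "M = (b - \<alpha>)\<^sup>2 + \<beta>\<^sup>2"
    and "K = (a - \<alpha>) * (b - \<alpha>) + \<beta>\<^sup>2"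
  have \<kappa>: "0 < \<kappa>" "\<kappa> < 1" and \<nu>: "\<nu> > 0" and \<delta>: "\<delta> > 0"
    and B: "\<delta>\<^sup>2 = M / L" "\<nu>\<^sup>2 = sqrt (L * M)" "2 * \<kappa>\<^sup>2 = 1 - K / sqrt (L * M)"
    using par by (auto simp: params_B_def L_def M_def K_def)
  have L: "L > 0" and M: "M > 0"
    using sep(2) by (auto simp: L_def M_def intro: add_nonneg_pos)
  \<comment> \<open>Free of square roots, the parameter formulas become M = \<nu>^2 \<delta>, L
    \<delta>^2 = M and K = \<nu>^2 (1 - 2 \<kappa>^2); only these enter the polynomial identity
    below.\<close>
  have M_eq: "M = \<nu>\<^sup>2 * \<delta>" and L_eq: "L * \<delta>\<^sup>2 = M"
  proof -
    have "\<delta> = sqrt (M / L)" using B(1) \<delta> by (simp add: real_sqrt_unique)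
    then have "\<nu>\<^sup>2 * \<delta> = sqrt ((L * M) * (M / L))" using B(2) by (simp only: real_sqrt_mult)
    also have "(L * M) * (M / L) = M\<^sup>2" using L by (simp add: power2_eq_square)
    finally show "M = \<nu>\<^sup>2 * \<delta>" using M by simp
    show "L * \<delta>\<^sup>2 = M" using B(1) L by simp
  qed
  have K_eq: "K = \<nu>\<^sup>2 * (1 - 2 * \<kappa>\<^sup>2)"
    unfolding B(3) using \<nu> by (simp flip: B(2))
  define sn cn dn where "sn x = jacobi_sn x \<kappa>" and "cn x = jacobi_cn x \<kappa>" and "dn x = jacobi_dn x \<kappa>"
    for x
  note J = has_derivative_jacobi_sn[OF \<kappa>, folded sn_def cn_def dn_def]
    has_derivative_jacobi_cn[OF \<kappa>, folded sn_def cn_def dn_def]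
    has_derivative_jacobi_dn[OF \<kappa>, folded sn_def cn_def dn_def]
  have sq: "(sn x)\<^sup>2 = 1 - (cn x)\<^sup>2" "(dn x)\<^sup>2 = 1 - \<kappa>\<^sup>2 + \<kappa>\<^sup>2 * (cn x)\<^sup>2" for x
  proof -
    show 1: "(sn x)\<^sup>2 = 1 - (cn x)\<^sup>2"
      using sn_squared_plus_cn_squared[OF \<kappa>, of x] by (simp add: sn_def cn_def)
    have "(dn x)\<^sup>2 = 1 - \<kappa>\<^sup>2 * (sn x)\<^sup>2" using dn_squared[OF \<kappa>, of x] by (simp add: sn_def dn_def)
    then show "(dn x)\<^sup>2 = 1 - \<kappa>\<^sup>2 + \<kappa>\<^sup>2 * (cn x)\<^sup>2" unfolding 1 by (simp add: algebra_simps)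
  qed
  have D: "1 + \<delta> + (\<delta> - 1) * cn x \<noteq> 0" for x
  proof -
    \<comment> \<open>An affine function of (1 + cn)/2, which lies in [0, 1], with the end values 2
      and 2\<delta>.\<close>
    have "1 + \<delta> + (\<delta> - 1) * cn x = 2 + (2 * \<delta> - 2) * ((1 + cn x) / 2)" by (simp add: field_simps)
    moreover have "-1 \<le> cn x" "cn x \<le> 1" by (simp_all add: cn_def jacobi_cn_def)
    ultimately show ?thesis
      using affine_between_nonzero[of 2 "2 * \<delta>" "(1 + cn x) / 2"] \<delta> by simp
  qed
  define S where "S x = cn (\<nu> * x)" for x
  define S1 where "S1 x = - \<nu> * (sn (\<nu> * x) * dn (\<nu> * x))" for x
  define G where "G s = \<nu>\<^sup>2 * ((1 - s\<^sup>2) * (1 - \<kappa>\<^sup>2 + \<kappa>\<^sup>2 * s\<^sup>2))" for s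
  define G1 where
    "G1 s = \<nu>\<^sup>2 * (- 2 * s * (1 - \<kappa>\<^sup>2 + \<kappa>\<^sup>2 * s\<^sup>2) + (1 - s\<^sup>2) * (2 * \<kappa>\<^sup>2 * s))" for s
  have scale: "((\<lambda>x. f (\<nu> * x)) has_real_derivative f' * \<nu>) (at x)"
    if "(f has_real_derivative f') (at (\<nu> * x))" for f f' x
    using DERIV_chain2[where f = f and g = "\<lambda>x. \<nu> * x", OF that] DERIV_cmult_Id by blast
  have det: "(a * \<delta> - b) * (1 + \<delta>) - (a * \<delta> + b) * (\<delta> - 1) = 2 * \<delta> * (a - b)"
    by (simp add: algebra_simps)
  have "mkdv_solution c d e (\<lambda>x. ((a * \<delta> + b) + (a * \<delta> - b) * S x) / ((1 + \<delta>) + (\<delta> - 1) * S x))"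
  proof (rule mkdv_solution_moebius)
    show "(a * \<delta> - b) * (1 + \<delta>) - (a * \<delta> + b) * (\<delta> - 1) \<noteq> 0"
      unfolding det using \<delta> sep(1) by simp
    show "(S has_real_derivative S1 x) (at x)" for x
      unfolding S_def by (rule DERIV_cong, (rule scale J)+) (simp add: S1_def)
    show "(S1 has_real_derivative G1 (S x) / 2) (at x)" for x
    proof -
      have "(S1 has_real_derivative - \<nu> * (\<nu> * (cn (\<nu> * x) * (dn (\<nu> * x))\<^sup>2 -
          \<kappa>\<^sup>2 * (sn (\<nu> * x))\<^sup>2 * cn (\<nu> * x)))) (at x)"
        unfolding S1_def
        by (rule DERIV_cong, (rule DERIV_cmult DERIV_mult scale J)+)
          (simp add: power2_eq_square algebra_simps)
      then show ?thesis
        unfolding sq S_def[symmetric] G1_def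
        by (rule DERIV_cong) (simp add: power2_eq_square algebra_simps)
    qed
    show "(S1 x)\<^sup>2 = G (S x)" for x
      by (simp add: S1_def G_def S_def power_mult_distrib sq)
    show "(G has_real_derivative G1 s) (at s)" for s
      unfolding G_def by (rule DERIV_cong, (rule derivative_intros)+) (simp add: G1_def algebra_simps)
    show "1 + \<delta> + (\<delta> - 1) * S x \<noteq> 0" for x
      using D by (simp add: S_def)
    show "((a * \<delta> - b) * (1 + \<delta>) - (a * \<delta> + b) * (\<delta> - 1))\<^sup>2 * G s =
        - poly (mkdv_P c d e) ((a * \<delta> + b + (a * \<delta> - b) * s) / (1 + \<delta> + (\<delta> - 1) * s)) *
        (1 + \<delta> + (\<delta> - 1) * s) ^ 4" if D: "1 + \<delta> + (\<delta> - 1) * s \<noteq> 0" for s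
    proof -
      define E where "E = 1 + \<delta> + (\<delta> - 1) * s"
      define v where "v = (a * \<delta> + b + (a * \<delta> - b) * s) / E"
      have vE: "v * E = a * \<delta> + b + (a * \<delta> - b) * s" using D by (simp add: v_def flip: E_def)
      have va: "(v - a) * E = (b - a) * (1 - s)"
        unfolding left_diff_distrib vE by (simp add: E_def algebra_simps)
      have vb: "(v - b) * E = - ((b - a) * \<delta> * (1 + s))"
        unfolding left_diff_distrib vE by (simp add: E_def algebra_simps)
      have v\<alpha>: "(v - \<alpha>) * E = (a - \<alpha>) * \<delta> * (1 + s) + (b - \<alpha>) * (1 - s)"
        unfolding left_diff_distrib vE by (simp add: E_def algebra_simps)
      have "((v - \<alpha>)\<^sup>2 + \<beta>\<^sup>2) * E\<^sup>2 = ((v - \<alpha>) * E)\<^sup>2 + \<beta>\<^sup>2 * (\<delta> * (1 + s) + (1 - s))\<^sup>2"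
        by (simp add: E_def power2_eq_square algebra_simps)
      also have "\<dots> = (L * \<delta>\<^sup>2) * (1 + s)\<^sup>2 + M * (1 - s)\<^sup>2 + 2 * K * \<delta> * (1 - s\<^sup>2)"
        unfolding v\<alpha> L_def M_def K_def by (simp add: power2_eq_square algebra_simps)
      \<comment> \<open>The choice of \<delta> gives (1 + s)^2 and (1 - s)^2 the same coefficient,
        so the terms linear in \<open>s\<close> cancel.\<close>
      also have "\<dots> = \<nu>\<^sup>2 * \<delta> * (1 + s)\<^sup>2 + \<nu>\<^sup>2 * \<delta> * (1 - s)\<^sup>2 + 2 * (\<nu>\<^sup>2 * (1 - 2 * \<kappa>\<^sup>2)) * \<delta> * (1 - s\<^sup>2)"
        unfolding L_eq K_eq by (simp only: M_eq)
      also have "\<dots> = 4 * \<nu>\<^sup>2 * \<delta> * (1 - \<kappa>\<^sup>2 + \<kappa>\<^sup>2 * s\<^sup>2)"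
        by (simp add: power2_eq_square algebra_simps)
      finally have quad: "((v - \<alpha>)\<^sup>2 + \<beta>\<^sup>2) * E\<^sup>2 = 4 * \<nu>\<^sup>2 * \<delta> * (1 - \<kappa>\<^sup>2 + \<kappa>\<^sup>2 * s\<^sup>2)" .
      have "poly (mkdv_P c d e) v * E ^ 4 = ((v - a) * E) * ((v - b) * E) * (((v - \<alpha>)\<^sup>2 + \<beta>\<^sup>2) * E\<^sup>2)"
        by (simp add: roots power4_eq_xxxx power2_eq_square ac_simps)
      also have "\<dots> = - ((2 * \<delta> * (a - b))\<^sup>2 * G s)"
        unfolding va vb quad G_def by (simp add: power2_eq_square algebra_simps)
      finally show ?thesis
        unfolding det E_def[symmetric] v_def[symmetric] by simp
    qed
  qed
  also have "(\<lambda>x. ((a * \<delta> + b) + (a * \<delta> - b) * S x) / ((1 + \<delta>) + (\<delta> - 1) * S x))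
      = form_B a b \<delta> \<nu> \<kappa>"
  proof
    fix x
    show "((a * \<delta> + b) + (a * \<delta> - b) * S x) / ((1 + \<delta>) + (\<delta> - 1) * S x) = form_B a b \<delta> \<nu> \<kappa> x"
      using D[of "\<nu> * x"] unfolding form_B_def S_def cn_def
      by (simp add: divide_simps) (simp add: algebra_simps)
  qed
  finally show "mkdv_solution c d e (form_B a b \<delta> \<nu> \<kappa>)" .
  show zero: "form_B a b \<delta> \<nu> \<kappa> 0 = a"
    by (simp add: form_B_def jacobi_cn_def \<kappa>)
  show "form_B a b \<delta> \<nu> \<kappa> (- x) = form_B a b \<delta> \<nu> \<kappa> x"
    by (simp add: form_B_def jacobi_cn_def jacobi_am_minus[OF \<kappa>])
  show "form_B a b \<delta> \<nu> \<kappa> (elliptic_F pi \<kappa> / \<nu>) = b"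
    using \<nu> by (simp add: form_B_def jacobi_cn_def \<kappa> field_simps)
  show "fundamental_period (form_B a b \<delta> \<nu> \<kappa>) (2 * elliptic_F pi \<kappa> / \<nu>)"
  proof (rule fundamental_periodI)
    show "0 < 2 * elliptic_F pi \<kappa> / \<nu>" using \<nu> elliptic_F_pos[OF \<kappa>, of pi] by simp
    show "form_B a b \<delta> \<nu> \<kappa> (x + 2 * elliptic_F pi \<kappa> / \<nu>) = form_B a b \<delta> \<nu> \<kappa> x" for x
    proof -
      have "\<nu> * (x + 2 * elliptic_F pi \<kappa> / \<nu>) = \<nu> * x + elliptic_F pi \<kappa> + elliptic_F pi \<kappa>"
        using \<nu> by (simp add: distrib_left)
      then have "jacobi_cn (\<nu> * (x + 2 * elliptic_F pi \<kappa> / \<nu>)) \<kappa> = jacobi_cn (\<nu> * x) \<kappa>"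
        by (simp only: jacobi_cn_add[OF \<kappa>] minus_minus)
      then show ?thesis by (simp only: form_B_def)
    qed
    fix y assume y: "0 < y" "y < 2 * elliptic_F pi \<kappa> / \<nu>"
    then have "cn (\<nu> * y) \<noteq> 1"
      using \<nu> unfolding cn_def by (intro jacobi_cn_not_1[OF \<kappa>]) (simp_all add: field_simps)
    then show "form_B a b \<delta> \<nu> \<kappa> y \<noteq> form_B a b \<delta> \<nu> \<kappa> 0"
      unfolding zero using D[of "\<nu> * y"] sep(1) by (simp add: form_B_def cn_def)
  qed
qed


subsection \<open>Real roots and solutions\<close>

text \<open>The inequalities are strict because a coincidence of neighbouring roots forces \<nu> =
  0, \<kappa> = 0 or \<kappa> = 1.\<close>

definition four_real_roots :: "real \<Rightarrow> real \<Rightarrow> real \<Rightarrow> bool" where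
  "four_real_roots c d e \<longleftrightarrow> (\<exists>u1 u2 u3 u4. u4 < u3 \<and> u3 < u2 \<and> u2 < u1 \<and>
     (\<forall>u. poly (mkdv_P c d e) u = (u - u1) * (u - u2) * (u - u3) * (u - u4)))"

definition two_real_roots :: "real \<Rightarrow> real \<Rightarrow> real \<Rightarrow> bool" where
  "two_real_roots c d e \<longleftrightarrow> (\<exists>a b \<alpha> \<beta>. b < a \<and> \<beta> \<noteq> 0 \<and>
     (\<forall>u. poly (mkdv_P c d e) u = (u - a) * (u - b) * ((u - \<alpha>)\<^sup>2 + \<beta>\<^sup>2)))"

lemma proots_linear_factors:
  fixes w x y z :: "'a :: idom"
  shows "proots ([:- w, 1:] * [:- x, 1:] * [:- y, 1:] * [:- z, 1:]) = {#w, x, y, z#}"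
proof -
  have "[:- v, 1:] \<noteq> 0" for v :: 'a by simp
  then show ?thesis by (simp add: proots_mult del: mult_pCons_left mult_pCons_right)
qed

lemma proots_of_real_roots:
  assumes "\<And>u. poly p u = (u - u1) * (u - u2) * (u - u3) * (u - u4)"
  shows "proots (p :: real poly) = {#u1, u2, u3, u4#}"
proof -
  have "p = [:- u1, 1:] * [:- u2, 1:] * [:- u3, 1:] * [:- u4, 1:]"
    by (subst poly_eq_poly_eq_iff[symmetric]) (simp add: fun_eq_iff assms algebra_simps)
  then show ?thesis by (simp only: proots_linear_factors)
qed

text \<open>The coefficients are written out so that \<open>map_poly\<close> can be evaluated; the
  complex factorization is then a comparison of coefficients.\<close>

lemma proots_of_complex_roots:
  assumes "\<And>u. poly p u = (u - a) * (u - b) * ((u - \<alpha>)\<^sup>2 + \<beta>\<^sup>2)"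
  shows "proots (map_poly complex_of_real p) =
    {#complex_of_real a, complex_of_real b, Complex \<alpha> \<beta>, Complex \<alpha> (- \<beta>)#}"
proof -
  define m where "m = \<alpha>\<^sup>2 + \<beta>\<^sup>2"
  have "p = [:a * b * m, - (a + b) * m - 2 * \<alpha> * a * b, m + 2 * \<alpha> * (a + b) + a * b, - (a + b) - 2 * \<alpha>, 1:]"
    by (subst poly_eq_poly_eq_iff[symmetric])
      (simp add: fun_eq_iff assms m_def power2_eq_square algebra_simps)
  then have "map_poly complex_of_real p = [:of_real (a * b * m), of_real (- (a + b) * m - 2 * \<alpha> * a * b),
      of_real (m + 2 * \<alpha> * (a + b) + a * b), of_real (- (a + b) - 2 * \<alpha>), 1:]"
    by (simp add: map_poly_pCons)
  also have "\<dots> = [:- of_real a, 1:] * [:- of_real b, 1:] * [:- Complex \<alpha> \<beta>, 1:] * [:- Complex \<alpha> (- \<beta>), 1:]"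
    by (simp add: complex_eq_iff m_def power2_eq_square algebra_simps)
  finally show ?thesis by (simp only: proots_linear_factors)
qed

lemma solutions_of_form_A_if_four_real_roots:
  assumes "four_real_roots c d e"
  shows "solutions_of_form_A c d e"
proof -
  obtain u1 u2 u3 u4 where ord: "u4 < u3" "u3 < u2" "u2 < u1"
    and roots: "\<And>u. poly (mkdv_P c d e) u = (u - u1) * (u - u2) * (u - u3) * (u - u4)"
    using assms unfolding four_real_roots_def by blast
  define N where "N = (u1 - u3) * (u2 - u4)"
  define \<nu> where "\<nu> = sqrt (N / 4)"
  define \<kappa> where "\<kappa> = sqrt ((u1 - u2) * (u3 - u4) / N)"
  have N: "N > 0" using ord by (simp add: N_def)
  have q: "0 < (u1 - u2) * (u3 - u4)" "(u1 - u2) * (u3 - u4) < N"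
  proof -
    show "0 < (u1 - u2) * (u3 - u4)" using ord by simp
    \<comment> \<open>This identity between the three pairings of the roots is what gives \<kappa> <
      1.\<close>
    have "N - (u1 - u2) * (u3 - u4) = (u1 - u4) * (u2 - u3)" by (simp add: N_def algebra_simps)
    moreover have "(u1 - u4) * (u2 - u3) > 0" using ord by simp
    ultimately show "(u1 - u2) * (u3 - u4) < N" by linarith
  qed
  have "\<nu>\<^sup>2 = N / 4" "\<kappa>\<^sup>2 = (u1 - u2) * (u3 - u4) / N"
    using N q by (simp_all add: \<nu>_def \<kappa>_def)
  then have par: "0 < \<nu>" "0 < \<kappa>" "\<kappa> < 1" "4 * \<nu>\<^sup>2 = (u1 - u3) * (u2 - u4)"
      "4 * \<nu>\<^sup>2 * \<kappa>\<^sup>2 = (u1 - u2) * (u3 - u4)"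
    using N q by (auto simp: \<nu>_def \<kappa>_def N_def[symmetric])
  \<comment> \<open>(S1), (S2) and (S3) leave both products unchanged, so one pair \<nu>, \<kappa>
    serves all four solutions.\<close>
  have sw: "(u2 - u4) * (u1 - u3) = (u1 - u3) * (u2 - u4)" "(u3 - u1) * (u4 - u2) = (u1 - u3) * (u2 - u4)"
      "(u4 - u2) * (u3 - u1) = (u1 - u3) * (u2 - u4)" "(u2 - u1) * (u4 - u3) = (u1 - u2) * (u3 - u4)"
      "(u3 - u4) * (u1 - u2) = (u1 - u2) * (u3 - u4)" "(u4 - u3) * (u2 - u1) = (u1 - u2) * (u3 - u4)"
    by (simp_all add: algebra_simps)
  have par: "params_A u1 u2 u3 u4 \<nu> \<kappa>" "params_A u2 u1 u4 u3 \<nu> \<kappa>"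
      "params_A u3 u4 u1 u2 \<nu> \<kappa>" "params_A u4 u3 u2 u1 \<nu> \<kappa>"
    using par unfolding params_A_def sw by simp_all
  have sep: "0 < (u1 - u4) * (u2 - u4)" "0 < (u2 - u3) * (u1 - u3)"
      "0 < (u3 - u2) * (u4 - u2)" "0 < (u4 - u1) * (u3 - u1)"
    using ord by (simp_all add: zero_less_mult_iff)
  define uA uS1 uS2 uS3 where "uA = form_A u1 u2 u3 u4 \<nu> \<kappa>" and "uS1 = form_A u2 u1 u4 u3 \<nu> \<kappa>"
    and "uS2 = form_A u3 u4 u1 u2 \<nu> \<kappa>" and "uS3 = form_A u4 u3 u2 u1 \<nu> \<kappa>"
  let ?T = "elliptic_F pi \<kappa> / \<nu>"
  define Good where "Good u l h \<longleftrightarrow> mkdv_solution c d e u \<and> fundamental_period u ?T \<and>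
    (\<forall>x. u (- x) = u x) \<and> u 0 = l \<and> u (elliptic_F (pi / 2) \<kappa> / \<nu>) = h" for u l h
  have mk: "Good (form_A w1 w2 w3 w4 \<nu> \<kappa>) w1 w2"
    if "params_A w1 w2 w3 w4 \<nu> \<kappa>"
      and "\<And>u. poly (mkdv_P c d e) u = (u - w1) * (u - w2) * (u - w3) * (u - w4)"
      and "0 < (w1 - w4) * (w2 - w4)" "w1 \<noteq> w2" for w1 w2 w3 w4
    unfolding Good_def
    by (intro conjI allI mkdv_solution_form_A[OF that] fundamental_period_form_A[OF that]
      form_A_minus[OF that] form_A_0[OF that] form_A_half_period[OF that])
  have good: "Good uA u1 u2" "Good uS1 u2 u1" "Good uS2 u3 u4" "Good uS3 u4 u3"
    unfolding uA_def uS1_def uS2_def uS3_def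
    by (rule mk; (rule par sep)?; use ord in \<open>simp add: roots ac_simps\<close>)+
  have trans: "translate_of v u" if "mkdv_solution c d e v" "Good u l h"
    "v 0 \<in> closed_segment l h" for u v l h
    by (rule translate_of_even_solution[OF _ that(1), where T = "elliptic_F (pi / 2) \<kappa> / \<nu>"])
      (use that(2,3) in \<open>simp_all add: Good_def\<close>)
  have orbits: "translate_of v uA \<and> translate_of v uS1 \<or> translate_of v uS2 \<and> translate_of v uS3"
    if v: "mkdv_solution c d e v" for v
  proof -
    have "poly (mkdv_P c d e) (v 0) \<le> 0"
      using mkdv_solutionD(3)[OF v, of 0] zero_le_power2[of "deriv v 0"] by linarith
    then have "v 0 \<in> {u2..u1} \<or> v 0 \<in> {u4..u3}"
    proof (rule contrapos_pp)
      assume "\<not> (v 0 \<in> {u2..u1} \<or> v 0 \<in> {u4..u3})"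
      then consider "v 0 > u1" | "u3 < v 0" "v 0 < u2" | "v 0 < u4" using ord by fastforce
      then have "0 < ((v 0 - u1) * (v 0 - u2)) * ((v 0 - u3) * (v 0 - u4))"
      proof cases
        case 1 then show ?thesis using ord by (intro mult_pos_pos) linarith+
      next
        case 2 then show ?thesis
          using ord by (intro mult_pos_pos[OF mult_neg_neg mult_pos_pos]) linarith+
      next
        case 3 then show ?thesis using ord by (intro mult_pos_pos[OF mult_neg_neg mult_neg_neg]) linarith+
      qed
      then show "\<not> poly (mkdv_P c d e) (v 0) \<le> 0" by (simp add: roots mult.assoc)
    qed
    \<comment> \<open>Each of the two bands belongs to two of the solutions, one starting at its
      upper end and one at its lower end.\<close>
    then show ?thesis
      using trans[OF v good(1)] trans[OF v good(2)] trans[OF v good(3)] trans[OF v good(4)] ord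
      by (auto simp: closed_segment_eq_real_ivl split: if_splits)
  qed
  have "uA 0 = u1" "uS1 0 = u2" "uS2 0 = u3" "uS3 0 = u4"
    using good unfolding Good_def by blast+
  then have dist: "distinct [uA, uS1, uS2, uS3]"
    using ord by auto
  have sols: "\<forall>u \<in> {uA, uS1, uS2, uS3}. mkdv_solution c d e u \<and> fundamental_period u ?T"
    using good unfolding Good_def by blast
  show ?thesis
    unfolding solutions_of_form_A_def
    by (rule exI[of _ u1], rule exI[of _ u2], rule exI[of _ u3], rule exI[of _ u4],
      rule exI[of _ \<nu>], rule exI[of _ \<kappa>], rule exI[of _ ?T], rule exI[of _ uA],
      rule exI[of _ uS1], rule exI[of _ uS2], rule exI[of _ uS3], intro conjI allI impI)
      (rule par ord[THEN less_imp_le] proots_of_real_roots[OF roots] uA_def uS1_def uS2_def uS3_def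
        dist sols orbits | assumption)+
qed

lemma solutions_of_form_B_if_two_real_roots:
  assumes "two_real_roots c d e"
  shows "solutions_of_form_B c d e"
proof -
  obtain a b \<alpha> \<beta> where ord: "b < a" and \<beta>: "\<beta> \<noteq> 0"
    and roots: "\<And>u. poly (mkdv_P c d e) u = (u - a) * (u - b) * ((u - \<alpha>)\<^sup>2 + \<beta>\<^sup>2)"
    using assms unfolding two_real_roots_def by blast
  define L M K where "L = (a - \<alpha>)\<^sup>2 + \<beta>\<^sup>2" and "M = (b - \<alpha>)\<^sup>2 + \<beta>\<^sup>2"
    and "K = (a - \<alpha>) * (b - \<alpha>) + \<beta>\<^sup>2"
  have L: "L > 0" and M: "M > 0" using \<beta> by (auto simp: L_def M_def intro: add_nonneg_pos)
  \<comment> \<open>Lagrange's identity for the vectors (a - \<alpha>, \<beta>) and (b - \<alpha>,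
    \<beta>). They are not parallel, so Cauchy-Schwarz is strict, which means 0 < \<kappa> <
    1.\<close>
  have "L * M = K\<^sup>2 + (\<beta> * (a - b))\<^sup>2"
    by (simp add: L_def M_def K_def power2_eq_square algebra_simps)
  moreover have "(\<beta> * (a - b))\<^sup>2 > 0" using \<beta> ord by simp
  ultimately have "K\<^sup>2 < L * M" by linarith
  then have "\<bar>K\<bar> < sqrt (L * M)" by (simp add: real_less_rsqrt)
  then have K: "-1 < K / sqrt (L * M)" "K / sqrt (L * M) < 1"
    using L M by (auto simp: field_simps abs_less_iff)
  define \<delta> \<nu> \<kappa> where "\<delta> = sqrt (M / L)" and "\<nu> = sqrt (sqrt (L * M))"
    and "\<kappa> = sqrt ((1 - K / sqrt (L * M)) / 2)"
  have "\<delta>\<^sup>2 = M / L" "\<nu>\<^sup>2 = sqrt (L * M)" "2 * \<kappa>\<^sup>2 = 1 - K / sqrt (L * M)"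
      "0 < \<delta>" "0 < \<nu>" "0 < \<kappa>" "\<kappa> < 1"
    using L M K by (auto simp: \<delta>_def \<nu>_def \<kappa>_def)
  then have par: "params_B a b \<alpha> \<beta> \<delta> \<nu> \<kappa>" "params_B b a \<alpha> \<beta> (inverse \<delta>) \<nu> \<kappa>"
    unfolding params_B_def L_def[symmetric] M_def[symmetric] K_def[symmetric]
    by (simp_all add: K_def power_inverse mult.commute)
  define uB uS0 where "uB = form_B a b \<delta> \<nu> \<kappa>" and "uS0 = form_B b a (inverse \<delta>) \<nu> \<kappa>"
  let ?T = "2 * elliptic_F pi \<kappa> / \<nu>"
  define Good where "Good u l h \<longleftrightarrow> mkdv_solution c d e u \<and> fundamental_period u ?T \<and>
    (\<forall>x. u (- x) = u x) \<and> u 0 = l \<and> u (elliptic_F pi \<kappa> / \<nu>) = h" for u l h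
  have roots': "poly (mkdv_P c d e) u = (u - b) * (u - a) * ((u - \<alpha>)\<^sup>2 + \<beta>\<^sup>2)" for u
    unfolding roots by simp
  have mk: "Good (form_B a' b' \<delta>' \<nu> \<kappa>) a' b'"
    if "params_B a' b' \<alpha> \<beta> \<delta>' \<nu> \<kappa>"
      and "\<And>u. poly (mkdv_P c d e) u = (u - a') * (u - b') * ((u - \<alpha>)\<^sup>2 + \<beta>\<^sup>2)"
      and "a' \<noteq> b'" for a' b' \<delta>'
    unfolding Good_def
    by (intro conjI allI mkdv_solution_form_B[OF that \<beta>] fundamental_period_form_B[OF that \<beta>]
      form_B_minus[OF that \<beta>] form_B_0[OF that \<beta>] form_B_half_period[OF that \<beta>])
  have good: "Good uB a b" "Good uS0 b a"
    unfolding uB_def uS0_def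
    by (rule mk; (rule par roots roots')?; use ord in simp)+
  have trans: "translate_of v u" if "mkdv_solution c d e v" "Good u l h"
    "v 0 \<in> closed_segment l h" for u v l h
    by (rule translate_of_even_solution[OF _ that(1), where T = "elliptic_F pi \<kappa> / \<nu>"])
      (use that(2,3) in \<open>simp_all add: Good_def\<close>)
  have orbits: "translate_of v uB \<and> translate_of v uS0" if v: "mkdv_solution c d e v" for v
  proof -
    have "poly (mkdv_P c d e) (v 0) \<le> 0"
      using mkdv_solutionD(3)[OF v, of 0] zero_le_power2[of "deriv v 0"] by linarith
    moreover have "(v 0 - \<alpha>)\<^sup>2 + \<beta>\<^sup>2 > 0" using \<beta> by (simp add: add_nonneg_pos)
    ultimately have "v 0 \<in> closed_segment a b" "v 0 \<in> closed_segment b a"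
      unfolding roots using ord by (auto simp: mult_le_0_iff closed_segment_eq_real_ivl)
    then show ?thesis
      using trans[OF v good(1)] trans[OF v good(2)] by simp
  qed
  have "uB 0 = a" "uS0 0 = b"
    using good unfolding Good_def by blast+
  then have dist: "uB \<noteq> uS0"
    using ord by auto
  have sols: "\<forall>u \<in> {uB, uS0}. mkdv_solution c d e u \<and> fundamental_period u ?T"
    using good unfolding Good_def by blast
  show ?thesis
    unfolding solutions_of_form_B_def
    by (rule exI[of _ a], rule exI[of _ b], rule exI[of _ \<alpha>], rule exI[of _ \<beta>],
      rule exI[of _ \<delta>], rule exI[of _ \<nu>], rule exI[of _ \<kappa>],
      rule exI[of _ ?T], rule exI[of _ uB], rule exI[of _ uS0], intro conjI allI impI)
      (rule par ord[THEN less_imp_le] \<beta> proots_of_complex_roots[OF roots] uB_def uS0_def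
        dist sols orbits[THEN conjunct1] orbits[THEN conjunct2] | assumption)+
qed


section \<open>Real roots of P from signs and monotonicity\<close>

lemma mkdv_P_has_derivative:
  "((\<lambda>u. poly (mkdv_P c d e) u) has_real_derivative 4 * u ^ 3 - 2 * c * u - 2 * e) (at u)"
  by (rule DERIV_cong[OF poly_DERIV]) (simp add: mkdv_P_def pderiv_pCons algebra_simps eval_nat_numeral)

lemma continuous_on_mkdv_P: "continuous_on A (\<lambda>u. poly (mkdv_P c d e) u)"
  by (intro continuous_intros)

lemma mkdv_P_increasing:
  assumes "x < y" "\<And>u. x < u \<Longrightarrow> u < y \<Longrightarrow> 4 * u ^ 3 - 2 * c * u - 2 * e > 0"
  shows "poly (mkdv_P c d e) x < poly (mkdv_P c d e) y"
  by (rule DERIV_pos_imp_increasing_open[OF assms(1)])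
    (use assms(2) mkdv_P_has_derivative continuous_on_mkdv_P in blast)+

lemma mkdv_P_decreasing:
  assumes "x < y" "\<And>u. x < u \<Longrightarrow> u < y \<Longrightarrow> 4 * u ^ 3 - 2 * c * u - 2 * e < 0"
  shows "poly (mkdv_P c d e) y < poly (mkdv_P c d e) x"
  by (rule DERIV_neg_imp_decreasing_open[OF assms(1)])
    (use assms(2) mkdv_P_has_derivative continuous_on_mkdv_P in blast)+

lemma mkdv_P_sign_change:
  assumes "x < y" "poly (mkdv_P c d e) x * poly (mkdv_P c d e) y < 0"
  obtains z where "x < z" "z < y" "poly (mkdv_P c d e) z = 0"
  using poly_IVT[OF assms] by blast

lemma four_real_rootsI:
  assumes ord: "x0 < x1" "x1 < x2" "x2 < x3" "x3 < x4"
    and pos: "poly (mkdv_P c d e) x0 > 0" "poly (mkdv_P c d e) x2 > 0" "poly (mkdv_P c d e) x4 > 0"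
    and neg: "poly (mkdv_P c d e) x1 < 0" "poly (mkdv_P c d e) x3 < 0"
  shows "four_real_roots c d e"
proof -
  let ?P = "mkdv_P c d e"
  obtain u4 where u4: "x0 < u4" "u4 < x1" "poly ?P u4 = 0"
    by (rule mkdv_P_sign_change[OF ord(1) mult_pos_neg]) (use pos neg in auto)
  obtain u3 where u3: "x1 < u3" "u3 < x2" "poly ?P u3 = 0"
    by (rule mkdv_P_sign_change[OF ord(2) mult_neg_pos]) (use pos neg in auto)
  obtain u2 where u2: "x2 < u2" "u2 < x3" "poly ?P u2 = 0"
    by (rule mkdv_P_sign_change[OF ord(3) mult_pos_neg]) (use pos neg in auto)
  obtain u1 where u1: "x3 < u1" "u1 < x4" "poly ?P u1 = 0"
    by (rule mkdv_P_sign_change[OF ord(4) mult_neg_pos]) (use pos neg in auto)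
  define Q where "Q = [:- u1, 1:] * [:- u2, 1:] * [:- u3, 1:] * [:- u4, 1:]"
  have poly_Q: "poly Q u = (u - u1) * (u - u2) * (u - u3) * (u - u4)" for u
    by (simp add: Q_def algebra_simps)
  \<comment> \<open>Both are monic quartics, so their difference has degree at most 3 and cannot
    have four distinct zeros unless it vanishes.\<close>
  have "?P = Q"
  proof (rule ccontr)
    assume "?P \<noteq> Q"
    then have nz: "?P - Q \<noteq> 0" by simp
    have "degree (?P - Q) \<le> 3"
      by (rule degree_le) (auto simp: mkdv_P_def Q_def coeff_pCons split: nat.splits)
    moreover have "{u1, u2, u3, u4} \<subseteq> {u. poly (?P - Q) u = 0}"
      using u1 u2 u3 u4 by (auto simp: poly_Q)
    then have "card {u1, u2, u3, u4} \<le> card {u. poly (?P - Q) u = 0}"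
      by (intro card_mono poly_roots_finite nz)
    moreover have "card {u1, u2, u3, u4} = 4" using u1 u2 u3 u4 by auto
    moreover have "card {u. poly (?P - Q) u = 0} \<le> degree (?P - Q)"
      by (rule card_poly_roots_bound[OF nz])
    ultimately show False by linarith
  qed
  with poly_Q have fac: "poly ?P u = (u - u1) * (u - u2) * (u - u3) * (u - u4)" for u
    by simp
  show ?thesis
    unfolding four_real_roots_def
    by (rule exI[of _ u1], rule exI[of _ u2], rule exI[of _ u3], rule exI[of _ u4])
      (use u1 u2 u3 u4 fac in auto)
qed

text \<open>The cofactor of the two real roots is a monic quadratic; a real zero of it would be a further
  or a multiple real root.\<close>

lemma two_real_rootsI_simple:
  assumes ord: "b < a" and P0: "poly (mkdv_P c d e) a = 0" "poly (mkdv_P c d e) b = 0"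
    and only: "\<And>u. poly (mkdv_P c d e) u = 0 \<Longrightarrow> u = a \<or> u = b"
    and simple: "4 * a ^ 3 - 2 * c * a - 2 * e \<noteq> 0" "4 * b ^ 3 - 2 * c * b - 2 * e \<noteq> 0"
  shows "two_real_roots c d e"
proof -
  let ?P = "mkdv_P c d e"
  \<comment> \<open>P has no cubic term, so the cofactor of (u - a)(u - b) has linear coefficient a
    + b; the coefficient -c of u^2 then determines its constant term \<open>m\<close>.\<close>
  define m where "m = a\<^sup>2 + a * b + b\<^sup>2 - c"
  define R where "R u = u\<^sup>2 + (a + b) * u + m" for u
  have eqs: "a ^ 4 - c * a\<^sup>2 + d - 2 * e * a = 0" "b ^ 4 - c * b\<^sup>2 + d - 2 * e * b = 0"
    using P0 by (simp_all add: poly_mkdv_P)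
  have "(a - b) * (2 * e - (a + b) * (a\<^sup>2 + b\<^sup>2 - c)) = 0"
    using eqs by algebra
  then have e: "2 * e = (a + b) * (a\<^sup>2 + b\<^sup>2 - c)" using ord by simp
  then have d: "d = a * b * m"
    using eqs(1) unfolding m_def by algebra
  have fac: "poly ?P u = (u - a) * (u - b) * R u" for u
    unfolding poly_mkdv_P R_def m_def d e by (simp add: algebra_simps power2_eq_square eval_nat_numeral)
  have R: "R u \<noteq> 0" for u
  proof
    assume R0: "R u = 0"
    then have "poly ?P u = 0" by (simp add: fac)
    then have u: "u = a \<or> u = b" by (rule only)
    \<comment> \<open>The product rule for P = (u - a)(u - b) R: a zero of \<open>R\<close> at
      \<open>a\<close> or \<open>b\<close> would be a double root, contrary to
      \<open>simple\<close>.\<close>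
    have "4 * u ^ 3 - 2 * c * u - 2 * e = (u - b) * R u + (u - a) * R u + (u - a) * (u - b) * (2 * u + a + b)"
      unfolding e R_def m_def by (simp add: algebra_simps power2_eq_square eval_nat_numeral)
    then show False using u R0 simple by auto
  qed
  define \<alpha> where "\<alpha> = - (a + b) / 2"
  have sq: "R u = (u - \<alpha>)\<^sup>2 + (m - \<alpha>\<^sup>2)" for u
    by (simp add: R_def \<alpha>_def power2_eq_square field_simps)
  have "m - \<alpha>\<^sup>2 > 0"
  proof (rule ccontr)
    assume "\<not> m - \<alpha>\<^sup>2 > 0"
    then have "R (\<alpha> + sqrt (\<alpha>\<^sup>2 - m)) = 0" by (simp add: sq)
    then show False using R by blast
  qed
  then have "(sqrt (m - \<alpha>\<^sup>2))\<^sup>2 = m - \<alpha>\<^sup>2" "sqrt (m - \<alpha>\<^sup>2) \<noteq> 0" by auto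
  then have "b < a \<and> sqrt (m - \<alpha>\<^sup>2) \<noteq> 0 \<and>
      (\<forall>u. poly ?P u = (u - a) * (u - b) * ((u - \<alpha>)\<^sup>2 + (sqrt (m - \<alpha>\<^sup>2))\<^sup>2))"
    using ord by (simp only: fac sq simp_thms)
  then show ?thesis
    unfolding two_real_roots_def by blast
qed

text \<open>One simple root lies in (q, p) and one beyond \<open>r\<close>, by strict monotonicity
  there. The point \<open>q\<close> is free: it may be a critical point where P is still positive,
  or lie far to the left of all roots.\<close>

lemma two_real_rootsI:
  assumes ord: "q \<le> p" "p \<le> r"
    and left: "\<And>u. u \<le> q \<Longrightarrow> poly (mkdv_P c d e) u > 0"
    and dec: "\<And>u. q < u \<Longrightarrow> u < p \<Longrightarrow> 4 * u ^ 3 - 2 * c * u - 2 * e < 0"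
    and neg: "\<And>u. p \<le> u \<Longrightarrow> u \<le> r \<Longrightarrow> poly (mkdv_P c d e) u < 0"
    and inc: "\<And>u. r < u \<Longrightarrow> 4 * u ^ 3 - 2 * c * u - 2 * e > 0"
  shows "two_real_roots c d e"
proof -
  let ?P = "mkdv_P c d e"
  define s where "s = max (r + 1) (1 + \<bar>c\<bar> + \<bar>d\<bar> + 2 * \<bar>e\<bar>)"
  have s: "r < s" "poly ?P s > 0"
    unfolding s_def by (simp, rule poly_mkdv_P_pos, simp add: max_def)
  have "q < p" using ord left[of q] neg[of p] by (cases "q = p") auto
  then obtain b where b: "q < b" "b < p" "poly ?P b = 0"
    by (rule mkdv_P_sign_change) (use left[of q] neg[of p] ord in \<open>auto intro: mult_pos_neg\<close>)
  obtain a where a: "r < a" "a < s" "poly ?P a = 0"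
    by (rule mkdv_P_sign_change[OF s(1)]) (use s neg[of r] ord in \<open>auto intro: mult_neg_pos\<close>)
  show ?thesis
  proof (rule two_real_rootsI_simple[of b a])
    show "b < a" using a b ord by linarith
    show "4 * a ^ 3 - 2 * c * a - 2 * e \<noteq> 0" using inc[of a] a by simp
    show "4 * b ^ 3 - 2 * c * b - 2 * e \<noteq> 0" using dec[of b] b by simp
    fix u assume u: "poly ?P u = 0"
    then have range: "q < u \<and> u < p \<or> r < u" using left[of u] neg[of u] by force
    show "u = a \<or> u = b"
    proof (rule ccontr)
      assume "\<not> (u = a \<or> u = b)"
      then consider "u < p" "u < b" | "u < p" "b < u" | "r < u" "u < a" | "r < u" "a < u"
        using range by linarith
      then show False
      proof cases
        case 1 then show False
          using mkdv_P_decreasing[of u b c e d] dec u a b range ord by auto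
      next
        case 2 then show False
          using mkdv_P_decreasing[of b u c e d] dec u a b range ord by auto
      next
        case 3 then show False
          using mkdv_P_increasing[of u a c e d] inc u a b range ord by auto
      next
        case 4 then show False
          using mkdv_P_increasing[of a u c e d] inc u a b range ord by auto
      qed
    qed
  qed (use a b in auto)
qed

lemma poly_mkdv_P_reflect: "poly (mkdv_P c d (- e)) u = poly (mkdv_P c d e) (- u)"
  by (simp add: poly_mkdv_P)

lemma four_real_roots_reflect:
  assumes "four_real_roots c d e"
  shows "four_real_roots c d (- e)"
proof -
  obtain u1 u2 u3 u4 where u: "u4 < u3" "u3 < u2" "u2 < u1"
     "\<And>u. poly (mkdv_P c d e) u = (u - u1) * (u - u2) * (u - u3) * (u - u4)"
    using assms unfolding four_real_roots_def by blast
  show ?thesis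
    unfolding four_real_roots_def poly_mkdv_P_reflect
    by (rule exI[of _ "- u4"], rule exI[of _ "- u3"], rule exI[of _ "- u2"],
      rule exI[of _ "- u1"])
      (use u(1-3) in \<open>auto simp: u(4) algebra_simps\<close>)
qed

lemma two_real_roots_reflect:
  assumes "two_real_roots c d e"
  shows "two_real_roots c d (- e)"
proof -
  obtain a b \<alpha> \<beta> where u: "b < a" "\<beta> \<noteq> 0"
     "\<And>u. poly (mkdv_P c d e) u = (u - a) * (u - b) * ((u - \<alpha>)\<^sup>2 + \<beta>\<^sup>2)"
    using assms unfolding two_real_roots_def by blast
  show ?thesis
    unfolding two_real_roots_def poly_mkdv_P_reflect
    by (rule exI[of _ "- b"], rule exI[of _ "- a"], rule exI[of _ "- \<alpha>"],
      rule exI[of _ \<beta>])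
      (use u(1,2) in \<open>auto simp: u(3) algebra_simps power2_eq_square\<close>)
qed


section \<open>Critical values of P and the thresholds for d\<close>

text \<open>With c = 6 s^2 the points -s and s are the critical points of P', and P'(-s) = 8 s^3 - 2
  e. So \<open>e_crit\<close> is the value of \<open>e\<close> at which the local maximum of P'
  drops to 0.\<close>

lemma e_crit_eq:
  assumes "0 < s"
  shows "e_crit (6 * s\<^sup>2) = 4 * s ^ 3"
proof -
  have eq: "(6 * s\<^sup>2) ^ 3 = (6 * s ^ 3)\<^sup>2 * 6"
    by (simp add: eval_nat_numeral algebra_simps)
  have "sqrt ((6 * s\<^sup>2) ^ 3) = 6 * s ^ 3 * sqrt 6"
    unfolding eq real_sqrt_mult real_sqrt_abs using assms by simp
  then show ?thesis by (simp add: e_crit_def)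
qed

text \<open>Subtracting the equations in pairs and cancelling the differences gives \<open>c\<close>
  and p + q + r = 0.\<close>

lemma cubic_factorization:
  fixes c e p q r u :: real
  assumes "p < q" "q < r"
    and "4 * p ^ 3 - 2 * c * p - 2 * e = 0" "4 * q ^ 3 - 2 * c * q - 2 * e = 0"
      "4 * r ^ 3 - 2 * c * r - 2 * e = 0"
  shows "4 * u ^ 3 - 2 * c * u - 2 * e = 4 * ((u - p) * (u - q) * (u - r))"
proof -
  have "(p - q) * (c - 2 * (p\<^sup>2 + p * q + q\<^sup>2)) = 0" using assms(3,4) by algebra
  then have c: "c = 2 * (p\<^sup>2 + p * q + q\<^sup>2)" using assms(1) by simp
  have "(p - r) * (c - 2 * (p\<^sup>2 + p * r + r\<^sup>2)) = 0" using assms(3,5) by algebra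
  then have "c = 2 * (p\<^sup>2 + p * r + r\<^sup>2)" using assms(1,2) by simp
  with c have "(q - r) * (p + q + r) = 0" by algebra
  then have r: "r = - (p + q)" using assms(2) by simp
  show ?thesis using c r assms(3) by algebra
qed

text \<open>P has minima at \<open>p\<close> and \<open>r\<close> and a local maximum at
  \<open>q\<close> between them. Varying \<open>d\<close> shifts the graph vertically, so the root
  count changes at -Q q, -Q p and -Q r, which are \<open>d1\<close>, \<open>d2\<close> and
  \<open>d3\<close>.\<close>

lemma subcritical_roots:
  assumes c: "0 < c" and e: "0 \<le> e" "e < e_crit c"
  shows "\<exists>d1 d2. d1 < d2 \<and> (\<forall>d. d1 < d \<and> d < d2 \<longrightarrow> four_real_roots c d e) \<and>
    (e \<noteq> 0 \<longrightarrow> (\<exists>d3 > d2. \<forall>d. d < d1 \<or> (d2 < d \<and> d < d3) \<longrightarrow> two_real_roots c d e))"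
proof -
  define s where "s = sqrt (c / 6)"
  have s: "s > 0" "c = 6 * s\<^sup>2" using c by (simp_all add: s_def)
  then have e4: "e < 4 * s ^ 3" using e(2) e_crit_eq[OF s(1)] by simp
  have s3: "s ^ 3 > 0" using s(1) by simp
  define g where "g u = 4 * u ^ 3 - 2 * c * u - 2 * e" for u
  have cont: "continuous_on A g" for A unfolding g_def by (intro continuous_intros)
  \<comment> \<open>At -2s, -s, s, 2s the value of \<open>g\<close> is -8 s^3, 8 s^3, -8 s^3, 8 s^3,
    each lowered by 2e; the signs isolate the three critical points.\<close>
  have vals: "g (- 2 * s) < 0" "g (- s) > 0" "g 0 \<le> 0" "g s < 0" "g (2 * s) > 0"
    using e(1) e4 s3 by (simp_all add: g_def s(2) power2_eq_square power3_eq_cube)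
  obtain p where p: "-2 * s \<le> p" "p \<le> - s" "g p = 0"
    using IVT'[of g "- 2 * s" 0 "- s"] vals cont s(1) by auto
  obtain q where q: "- s \<le> q" "q \<le> 0" "g q = 0"
    using IVT2'[of g 0 0 "- s"] vals cont s(1) by auto
  obtain r where r: "s \<le> r" "r \<le> 2 * s" "g r = 0"
    using IVT'[of g s 0 "2 * s"] vals cont s(1) by auto
  have "p \<noteq> - s" "q \<noteq> - s" using p(3) q(3) vals by auto
  with p q r s(1) have ord: "p < q" "q < r" "p < 0" "q < - p" by auto
  have g: "g u = 4 * ((u - p) * (u - q) * (u - r))" for u
    unfolding g_def using cubic_factorization[OF ord(1,2)] p(3) q(3) r(3) unfolding g_def by blast
  have sgn: "g u < 0" if "u < p" for u
    using that ord unfolding g by (auto simp: mult_less_0_iff zero_less_mult_iff)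
  have sgn2: "g u > 0" if "p < u" "u < q" for u
    using that ord unfolding g by (auto simp: mult_less_0_iff zero_less_mult_iff)
  have sgn3: "g u < 0" if "q < u" "u < r" for u
    using that ord unfolding g by (auto simp: mult_less_0_iff zero_less_mult_iff)
  have sgn4: "g u > 0" if "r < u" for u
    using that ord unfolding g by (auto simp: mult_less_0_iff zero_less_mult_iff)
  note sgn = sgn sgn2 sgn3 sgn4
  define Q where "Q u = poly (mkdv_P c 0 e) u" for u
  have P: "poly (mkdv_P c d e) u = Q u + d" for d u by (simp add: Q_def poly_mkdv_P)
  have mono: "Q x > Q y" if "x < y" "y \<le> p" for x y
    unfolding Q_def by (rule mkdv_P_decreasing) (use that sgn[unfolded g_def] in force)+
  have mono2: "Q x < Q y" if "x < y" "p \<le> x" "y \<le> q" for x y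
    unfolding Q_def by (rule mkdv_P_increasing) (use that sgn[unfolded g_def] in force)+
  have mono3: "Q x > Q y" if "x < y" "q \<le> x" "y \<le> r" for x y
    unfolding Q_def by (rule mkdv_P_decreasing) (use that sgn[unfolded g_def] in force)+
  have mono4: "Q x < Q y" if "x < y" "r \<le> x" for x y
    unfolding Q_def by (rule mkdv_P_increasing) (use that sgn[unfolded g_def] in force)+
  have Qpq: "Q p < Q q" using mono2 ord by simp
  \<comment> \<open>The minima are compared through the mirror point -p, which lies to the right of
    \<open>q\<close>, where \<open>r\<close> is the minimizer; reflection changes only the term
    linear in \<open>u\<close>.\<close>
  have "Q r \<le> Q (- p)"
    using mono3[of "- p" r] mono4[of r "- p"] ord by (cases "- p" r rule: linorder_cases) auto
  moreover have "Q (- p) = Q p + 4 * (e * p)" by (simp add: Q_def poly_mkdv_P)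
  moreover have "e * p \<le> 0" "e \<noteq> 0 \<Longrightarrow> e * p < 0"
    using e(1) ord(3) by (auto simp: mult_le_0_iff mult_less_0_iff)
  ultimately have Qrp: "Q r \<le> Q p" "e \<noteq> 0 \<Longrightarrow> Q r < Q p" by auto
  define R where "R d = 1 + \<bar>c\<bar> + \<bar>d\<bar> + 2 * \<bar>e\<bar>" for d
  have far: "poly (mkdv_P c d e) u > 0" if "\<bar>u\<bar> \<ge> R d" for d u
    using that unfolding R_def by (rule poly_mkdv_P_pos)
  have "four_real_roots c d e" if "- Q q < d" "d < - Q p" for d
  proof (rule four_real_rootsI[of "min (p - 1) (- R d)" p q r "max (r + 1) (R d)"])
    show "min (p - 1) (- R d) < p" "r < max (r + 1) (R d)" by auto
    show "poly (mkdv_P c d e) (min (p - 1) (- R d)) > 0" "poly (mkdv_P c d e) (max (r + 1) (R d)) > 0"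
      by (rule far, simp add: R_def min_def max_def)+
    show "poly (mkdv_P c d e) q > 0" "poly (mkdv_P c d e) p < 0" "poly (mkdv_P c d e) r < 0"
      using that Qrp by (simp_all add: P)
  qed (use ord in auto)
  \<comment> \<open>Even the local maximum is below 0, so all of [p, r] is negative.\<close>
  moreover have "two_real_roots c d e" if "d < - Q q" for d
  proof (rule two_real_rootsI[of "min p (- R d)" p r])
    show "min p (- R d) \<le> p" "p \<le> r" using ord by auto
    show "poly (mkdv_P c d e) u > 0" if "u \<le> min p (- R d)" for u
      using that by (intro far) auto
    show "poly (mkdv_P c d e) u < 0" if "p \<le> u" "u \<le> r" for u
    proof -
      have "Q u \<le> Q q"
        using mono2[of u q] mono3[of q u] that by (cases u q rule: linorder_cases) auto
      then show ?thesis using \<open>d < - Q q\<close> by (simp add: P)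
    qed
  qed (use sgn[unfolded g_def] in auto)
  \<comment> \<open>The left well has been lifted above 0 and only the right one still dips below
    it.\<close>
  moreover have "two_real_roots c d e" if d: "- Q p < d" "d < - Q r" for d
  proof (rule two_real_rootsI[of q r r])
    show "q \<le> r" "r \<le> r" using ord by auto
    show "poly (mkdv_P c d e) u > 0" if "u \<le> q" for u
    proof -
      have "Q p \<le> Q u"
        using mono[of u p] mono2[of p u] that by (cases u p rule: linorder_cases) auto
      then show ?thesis using d by (simp add: P)
    qed
    show "poly (mkdv_P c d e) u < 0" if "r \<le> u" "u \<le> r" for u
      using that d by (simp add: P)
  qed (use sgn[unfolded g_def] in auto)
  ultimately show ?thesis
    using Qpq Qrp(2) by (intro exI[of _ "- Q q"] exI[of _ "- Q p"]) (auto intro!: exI[of _ "- Q r"])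
qed

text \<open>The point \<open>r\<close> is the largest zero of P'. It is sought to the right of 2
  sqrt(c/6) (of 0 if c \<le> 0), because this position gives the last inequality, by which P' / (u -
  r) does not change sign.\<close>

lemma supercritical_critical_point:
  assumes e: "0 \<le> e" and c: "c \<le> 0 \<or> 0 < c \<and> e_crit c \<le> e"
  obtains r where "0 \<le> r" "e = 2 * r ^ 3 - c * r" "2 * c \<le> 3 * r\<^sup>2"
proof -
  define g where "g u = 4 * u ^ 3 - 2 * c * u - 2 * e" for u
  have cont: "continuous_on A g" for A unfolding g_def by (intro continuous_intros)
  define s where "s = (if c \<le> 0 then 0 else sqrt (c / 6))"
  have s: "0 \<le> s" "c \<le> 6 * s\<^sup>2" by (auto simp: s_def)
  have "g (2 * s) \<le> 0"
  proof (cases "c \<le> 0")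
    case True then show ?thesis using e by (simp add: g_def s_def)
  next
    case False
    then have "s > 0" "c = 6 * s\<^sup>2" by (simp_all add: s_def)
    then show ?thesis using c False e_crit_eq[of s]
      by (simp add: g_def power2_eq_square power3_eq_cube)
  qed
  \<comment> \<open>Large enough to split 4 m^3 into 3 m^3 \<ge> 2 c m and m^3 \<ge> 2 e.\<close>
  define m where "m = 2 * s + 1 + e"
  have m: "m \<ge> 2 * s" "m \<ge> 1 + e" "m \<ge> 1" using s e by (auto simp: m_def)
  have "g m \<ge> 0"
  proof -
    have "(2 * s)\<^sup>2 \<le> m\<^sup>2" using m s by (intro power_mono) auto
    then have "2 * c \<le> 3 * m\<^sup>2" using s(2) by (simp add: power2_eq_square)
    then have "2 * c * m \<le> 3 * m\<^sup>2 * m" using m(3) by (intro mult_right_mono) auto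
    moreover have "2 * e \<le> m ^ 3"
    proof -
      have "2 * e \<le> (1 + e)\<^sup>2" by (simp add: power2_sum)
      also have "\<dots> \<le> m\<^sup>2" using m e by (intro power_mono) auto
      also have "\<dots> \<le> m ^ 3" using m(3) by (intro power_increasing) auto
      finally show ?thesis .
    qed
    ultimately show ?thesis by (simp add: g_def power2_eq_square power3_eq_cube)
  qed
  then obtain r where r: "2 * s \<le> r" "g r = 0"
    using IVT'[of g "2 * s" 0 m] \<open>g (2 * s) \<le> 0\<close> m cont by auto
  have "(2 * s)\<^sup>2 \<le> r\<^sup>2" using r s by (intro power_mono) auto
  then show ?thesis
    using r s by (intro that[of r]) (auto simp: g_def power2_eq_square)
qed

text \<open>At most one zero \<open>- r/2\<close> of \<open>P'\<close> besides \<open>r\<close>, and \<open>P'\<close> does not change sign there; the sign of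
  \<open>P\<close> at this point decides on which side of it the smaller root lies.\<close>

lemma supercritical_roots:
  assumes e: "0 \<le> e" and c: "c \<le> 0 \<or> 0 < c \<and> e_crit c \<le> e"
  shows "\<exists>d1. (if c \<le> 0 \<and> e = 0 then d1 = 0 else 0 < d1) \<and>
    (\<forall>d < d1. \<not> (0 < c \<and> e = e_crit c \<and> d = - c\<^sup>2 / 12) \<longrightarrow> two_real_roots c d e)"
proof -
  obtain r where r: "0 \<le> r" and er: "e = 2 * r ^ 3 - c * r" and cr: "2 * c \<le> 3 * r\<^sup>2"
    using supercritical_critical_point[OF e c] .
  \<comment> \<open>The remainder after completing the square in the quadratic cofactor of u - r in
    P'/4.\<close>
  define k where "k = 3 * r\<^sup>2 / 4 - c / 2"
  have k: "k \<ge> 0" using cr by (simp add: k_def)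
  have g: "4 * u ^ 3 - 2 * c * u - 2 * e = 4 * ((u - r) * ((u + r / 2)\<^sup>2 + k))" for u
    by (simp add: er k_def power2_eq_square power3_eq_cube field_simps)
  have quad: "(u + r / 2)\<^sup>2 + k > 0" if "u \<noteq> - r / 2" for u
    using that k by (intro add_pos_nonneg) auto
  have neg: "4 * u ^ 3 - 2 * c * u - 2 * e < 0" if "u < r" "u \<noteq> - r / 2" for u
    unfolding g using mult_neg_pos[OF _ quad[OF that(2)], of "u - r"] that(1) by simp
  have pos: "4 * u ^ 3 - 2 * c * u - 2 * e > 0" if "r < u" for u
    unfolding g using mult_pos_pos[OF _ quad, of "u - r" u] that r by simp
  define Q where "Q u = poly (mkdv_P c 0 e) u" for u
  have P: "poly (mkdv_P c d e) u = Q u + d" for d u by (simp add: Q_def poly_mkdv_P)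
  have mono: "Q x > Q y" if "x < y" "y \<le> - r / 2" for x y
    unfolding Q_def by (rule mkdv_P_decreasing) (use that neg r in force)+
  have mono2: "Q x > Q y" if "x < y" "- r / 2 \<le> x" "y \<le> r" for x y
    unfolding Q_def by (rule mkdv_P_decreasing) (use that neg r in force)+
  have Qr: "- Q r = r\<^sup>2 * (3 * r\<^sup>2 - c)"
    by (simp add: Q_def poly_mkdv_P er eval_nat_numeral algebra_simps)
  \<comment> \<open>The threshold -Q r is minus the global minimum of \<open>Q\<close>. It vanishes
    only for r = 0, which forces c \<le> 0 and e = 0.\<close>
  have "if c \<le> 0 \<and> e = 0 then - Q r = 0 else 0 < - Q r"
  proof (cases "r = 0")
    case True
    then show ?thesis using cr er Qr by auto
  next
    case False
    then have r0: "r > 0" "r\<^sup>2 > 0" using r by auto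
    then have "3 * r\<^sup>2 - c > 0" using cr by linarith
    then have "- Q r > 0" unfolding Qr using r0 by simp
    moreover have "\<not> (c \<le> 0 \<and> e = 0)"
    proof
      assume "c \<le> 0 \<and> e = 0"
      moreover have "e = r * (2 * r\<^sup>2 - c)" by (simp add: er power2_eq_square power3_eq_cube algebra_simps)
      ultimately show False using r0 by auto
    qed
    ultimately show ?thesis by simp
  qed
  moreover have "two_real_roots c d e"
    if d: "d < - Q r" and ex: "\<not> (0 < c \<and> e = e_crit c \<and> d = - c\<^sup>2 / 12)" for d
  proof -
    define R where "R = 1 + \<bar>c\<bar> + \<bar>d\<bar> + 2 * \<bar>e\<bar>"
    have far: "poly (mkdv_P c d e) u > 0" if "\<bar>u\<bar> \<ge> R" for u
      using that unfolding R_def by (rule poly_mkdv_P_pos)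
    consider "Q (- r / 2) + d < 0" | "Q (- r / 2) + d > 0" | "Q (- r / 2) + d = 0" by linarith
    then show ?thesis
    proof cases
      case 1
      show ?thesis
      proof (rule two_real_rootsI[of "min (- r / 2) (- R)" "- r / 2" r])
        show "min (- r / 2) (- R) \<le> - r / 2" "- r / 2 \<le> r" using r by auto
        show "poly (mkdv_P c d e) u > 0" if "u \<le> min (- r / 2) (- R)" for u
          using that by (intro far) auto
        show "poly (mkdv_P c d e) u < 0" if "- r / 2 \<le> u" "u \<le> r" for u
          using mono2[of "- r / 2" u] 1 that by (cases "u = - r / 2") (auto simp: P)
      qed (use pos neg r in auto)
    next
      case 2
      show ?thesis
      proof (rule two_real_rootsI[of "- r / 2" r r])
        show "- r / 2 \<le> r" "r \<le> r" using r by auto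
        show "poly (mkdv_P c d e) u > 0" if "u \<le> - r / 2" for u
          using mono[of u "- r / 2"] 2 that by (cases "u = - r / 2") (auto simp: P)
        show "poly (mkdv_P c d e) u < 0" if "r \<le> u" "u \<le> r" for u
          using that d by (simp add: P)
      qed (use pos neg in auto)
    next
      case 3
      have r0: "r > 0" using 3 d r by (cases "r = 0") auto
      \<comment> \<open>Here -r/2 is itself a root. With k = 0 it would be the triple root of the
        excluded value of \<open>d\<close>; with k > 0 the derivative is negative there and the root
        is simple.\<close>
      have "k \<noteq> 0"
      proof
        assume "k = 0"
        then have cc: "c = 6 * (r / 2)\<^sup>2" by (simp add: k_def power2_eq_square)
        then have "e_crit c = 4 * (r / 2) ^ 3" using e_crit_eq[of "r / 2"] r0 by simp
        then have "e = e_crit c" by (simp add: er cc power2_eq_square power3_eq_cube)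
        moreover have "d = - c\<^sup>2 / 12"
          using 3 by (simp add: Q_def poly_mkdv_P er cc eval_nat_numeral field_simps)
        moreover have "c > 0" using r0 by (simp add: cc)
        ultimately show False using ex by simp
      qed
      then have "(u + r / 2)\<^sup>2 + k > 0" for u using k by (intro add_nonneg_pos) auto
      then have neg': "4 * u ^ 3 - 2 * c * u - 2 * e < 0" if "u < r" for u
        unfolding g using mult_neg_pos[of "u - r"] that by simp
      show ?thesis
      proof (rule two_real_rootsI[of "min r (- R)" r r])
        show "min r (- R) \<le> r" "r \<le> r" by auto
        show "poly (mkdv_P c d e) u > 0" if "u \<le> min r (- R)" for u
          using that by (intro far) auto
        show "poly (mkdv_P c d e) u < 0" if "r \<le> u" "u \<le> r" for u
          using that d by (simp add: P)
      qed (use pos neg' in auto)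
    qed
  qed
  ultimately show ?thesis by (intro exI[of _ "- Q r"]) simp
qed

lemma four_real_roots_abs: "four_real_roots c d \<bar>e\<bar> \<Longrightarrow> four_real_roots c d e"
  using four_real_roots_reflect[of c d "- e"] by (cases "e \<ge> 0") auto

lemma two_real_roots_abs: "two_real_roots c d \<bar>e\<bar> \<Longrightarrow> two_real_roots c d e"
  using two_real_roots_reflect[of c d "- e"] by (cases "e \<ge> 0") auto

(* Two degenerate cases are treated separately for other values of (c, e). If c <= 0 and e = 0,
   then P > 0 for d > 0 and there is no solution at all, so the threshold is 0 instead of positive.
   If c > 0 and |e| = e_crit c, then P has a triple real root for d = - c^2 / 12 and
   the solutions are a constant and an algebraic soliton, so this single value of d is left out. *)
theorem theorem1:
  fixes c e :: real
  shows "(0 < c \<and> \<bar>e\<bar> < e_crit c \<longrightarrow>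
            (\<exists>d1 d2. d1 < d2 \<and>
               (\<forall>d. d1 < d \<and> d < d2 \<longrightarrow> solutions_of_form_A c d e) \<and>
               (e \<noteq> 0 \<longrightarrow>
                  (\<exists>d3 > d2. \<forall>d. d < d1 \<or> (d2 < d \<and> d < d3) \<longrightarrow> solutions_of_form_B c d e)))) \<and>
         (c \<le> 0 \<or> (0 < c \<and> \<bar>e\<bar> \<ge> e_crit c) \<longrightarrow>
            (\<exists>d1. (if c \<le> 0 \<and> e = 0 then d1 = 0 else 0 < d1) \<and>
               (\<forall>d < d1. \<not> (0 < c \<and> \<bar>e\<bar> = e_crit c \<and> d = - c\<^sup>2 / 12) \<longrightarrow>
                  solutions_of_form_B c d e)))"
proof (intro conjI impI)
  assume "0 < c \<and> \<bar>e\<bar> < e_crit c"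
  then obtain d1 d2 where "d1 < d2" "\<forall>d. d1 < d \<and> d < d2 \<longrightarrow> four_real_roots c d \<bar>e\<bar>"
    "\<bar>e\<bar> \<noteq> 0 \<longrightarrow> (\<exists>d3 > d2. \<forall>d. d < d1 \<or> (d2 < d \<and> d < d3) \<longrightarrow> two_real_roots c d \<bar>e\<bar>)"
    using subcritical_roots[of c "\<bar>e\<bar>"] by auto
  then show "\<exists>d1 d2. d1 < d2 \<and>
      (\<forall>d. d1 < d \<and> d < d2 \<longrightarrow> solutions_of_form_A c d e) \<and>
      (e \<noteq> 0 \<longrightarrow> (\<exists>d3 > d2. \<forall>d. d < d1 \<or> (d2 < d \<and> d < d3) \<longrightarrow> solutions_of_form_B c d e))"
    using solutions_of_form_A_if_four_real_roots[OF four_real_roots_abs]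
      solutions_of_form_B_if_two_real_roots[OF two_real_roots_abs]
    by (metis abs_eq_0)
next
  assume "c \<le> 0 \<or> 0 < c \<and> \<bar>e\<bar> \<ge> e_crit c"
  then obtain d1 where "if c \<le> 0 \<and> \<bar>e\<bar> = 0 then d1 = 0 else 0 < d1"
    "\<forall>d < d1. \<not> (0 < c \<and> \<bar>e\<bar> = e_crit c \<and> d = - c\<^sup>2 / 12) \<longrightarrow> two_real_roots c d \<bar>e\<bar>"
    using supercritical_roots[of "\<bar>e\<bar>" c] by auto
  then show "\<exists>d1. (if c \<le> 0 \<and> e = 0 then d1 = 0 else 0 < d1) \<and>
      (\<forall>d < d1. \<not> (0 < c \<and> \<bar>e\<bar> = e_crit c \<and> d = - c\<^sup>2 / 12) \<longrightarrow> solutions_of_form_B c d e)"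
    using solutions_of_form_B_if_two_real_roots[OF two_real_roots_abs]
    by (intro exI[of _ d1]) auto
qed

end
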